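(* Let $X$ be a compact metric space and let $f:X\to X$ be a topologically transitive homeomorphism satisfying the closing property. Let $m\in\mathbb N$, $\alpha>0$, and let $A:X\to GL(m,\mathbb R)$ be an $\alpha$-H\"older function, generating the cocycle $\mathcal A$ over $f$. Suppose that there exists a compact set $K\subset GL(m,\mathbb R)$ such that $\mathcal A(p,n)\in K$ for all $p\in X$ and $n\in\mathbb N$ with $f^np=p$. Then there exists a compact set $K'\subset GL(m,\mathbb R)$ such that $\mathcal A(x,n)\in K'$ for all $x\in X$ and $n\in\mathbb Z$.
   Context: $\mathbb N$ denotes the positive integers. A homeomorphism $f$ of $X$ is topologically transitive if it has a dense orbit $\{f^kz\}_{k\in\mathbb Z}$ for some $z\in X$. For $\lambda>0$, orbit segments $x,fx,\dots,f^nx$ and $p,fp,\dots,f^np$ are called exponentially $\delta$ close with exponent $\lambda$ if $\mathrm{dist}(f^ix,f^ip)\le\delta\exp(-\lambda\min\{i,n-i\})$ for every $i=0,\dots,n$. A homeomorphism $f$ of a metric space $X$ satisfies the closing property if there exist $c,\lambda,\delta_0>0$ such that for any $x\in X$ and $n>0$ with $\mathrm{dist}(x,f^nx)<\delta_0$ there exists $p\in X$ with $f^np=p$ such that, with $\delta=c\,\mathrm{dist}(x,f^nx)$, the orbit segments $x,fx,\dots,f^nx$ and $p,fp,\dots,f^np$ are exponentially $\delta$ close with exponent $\lambda$, and there exists $y\in X$ such that for every $i=0,\dots,n$ $$\mathrm{dist}(f^ip,f^iy)\le\delta e^{-\lambda i}\quad\text{and}\quad \mathrm{dist}(f^iy,f^ix)\le\delta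 e^{-\lambda(n-i)}.$$ The cocycle $\mathcal A:X\times\mathbb Z\to GL(m,\mathbb R)$ generated by $A$ is given by $\mathcal A(x,0)=\mathrm{Id}$, $\mathcal A(x,n)=A(f^{n-1}x)\cdots A(fx)A(x)$ and $\mathcal A(x,-n)=\mathcal A(f^{-n}x,n)^{-1}$ for $n>0$. $GL(m,\mathbb R)$ carries the metric $\mathrm{dist}(A,B)=\|A-B\|+\|A^{-1}-B^{-1}\|$, where $\|\cdot\|$ is the operator norm for the standard Euclidean norm on $\mathbb R^m$. A function $A:X\to GL(m,\mathbb R)$ is $\alpha$-H\"older if it is H\"older continuous with exponent $\alpha$ with respect to this metric; since $X$ is compact this is equivalent to the existence of a constant $c$ with $\|A(x)-A(y)\|\le c\,\mathrm{dist}(x,y)^\alpha$ for all $x,y\in X$. *)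

theory Defs
  imports "HOL-Analysis.Analysis"
begin

definition iterate :: "('a \<Rightarrow> 'a) \<Rightarrow> int \<Rightarrow> 'a \<Rightarrow> 'a" where
  "iterate f k = (if 0 \<le> k then f ^^ nat k else inv f ^^ nat (- k))"

definition topologically_transitive :: "('a::topological_space \<Rightarrow> 'a) \<Rightarrow> bool" where
  "topologically_transitive f \<longleftrightarrow> (\<exists>z. closure (range (\<lambda>k::int. iterate f k z)) = UNIV)"

definition exponentially_close ::
    "('a::metric_space \<Rightarrow> 'a) \<Rightarrow> real \<Rightarrow> real \<Rightarrow> nat \<Rightarrow> 'a \<Rightarrow> 'a \<Rightarrow> bool" where
  "exponentially_close f lam \<delta> n x p \<longleftrightarrow>
     (\<forall>i\<le>n. dist ((f ^^ i) x) ((f ^^ i) p) \<le> \<delta> * exp (- lam * real (min i (n - i))))"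

definition closing_property :: "('a::metric_space \<Rightarrow> 'a) \<Rightarrow> bool" where
  "closing_property f \<longleftrightarrow>
     (\<exists>c lam \<delta>\<^sub>0. c > 0 \<and> lam > 0 \<and> \<delta>\<^sub>0 > 0 \<and>
       (\<forall>x. \<forall>n>0. dist x ((f ^^ n) x) < \<delta>\<^sub>0 \<longrightarrow>
         (\<exists>p. (f ^^ n) p = p \<and>
            (let \<delta> = c * dist x ((f ^^ n) x) in
               exponentially_close f lam \<delta> n x p \<and>
               (\<exists>y. \<forall>i\<le>n.
                  dist ((f ^^ i) p) ((f ^^ i) y) \<le> \<delta> * exp (- lam * real i) \<and>
                  dist ((f ^^ i) y) ((f ^^ i) x) \<le> \<delta> * exp (- lam * real (n - i)))))))"

definition GL :: "(real^'m^'m) set" where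
  "GL = {A. invertible A}"

text \<open>The norm of the library on \<open>real^'m^'m\<close> is the Frobenius norm, so the operator norm
  has to be written explicitly.\<close>

definition GL_dist :: "real^'m^'m \<Rightarrow> real^'m^'m \<Rightarrow> real" where
  "GL_dist A B = onorm ((*v) (A - B)) + onorm ((*v) (matrix_inv A - matrix_inv B))"

lemma Metric_space_GL: "Metric_space (GL :: (real^'m^'m) set) GL_dist"
proof
  have bl: "bounded_linear ((*v) M)" for M :: "real^'m^'m"
    by (rule matrix_vector_mul_bounded_linear)
  have neg: "onorm ((*v) (M - N)) = onorm ((*v) (N - M))" for M N :: "real^'m^'m"
  proof -
    have "(*v) (N - M) = (\<lambda>v. - ((M - N) *v v))"
      by (simp add: fun_eq_iff matrix_vector_mult_diff_rdistrib)
    then show ?thesis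
      using onorm_neg[of "(*v) (M - N)"] by simp
  qed
  have tri: "onorm ((*v) (L - N)) \<le> onorm ((*v) (L - M)) + onorm ((*v) (M - N))"
    for L M N :: "real^'m^'m"
  proof -
    have "(*v) (L - N) = (\<lambda>v. (L - M) *v v + (M - N) *v v)"
      by (simp add: fun_eq_iff matrix_vector_mult_diff_rdistrib)
    then show ?thesis
      using onorm_triangle[OF bl[of "L - M"] bl[of "M - N"]] by simp
  qed
  fix A B C :: "real^'m^'m"
  show "0 \<le> GL_dist A B"
    unfolding GL_dist_def by (intro add_nonneg_nonneg onorm_pos_le bl)
  show "GL_dist A B = GL_dist B A"
    unfolding GL_dist_def using neg by metis
  show "GL_dist A B = 0 \<longleftrightarrow> A = B"
  proof
    assume "GL_dist A B = 0"
    then have "onorm ((*v) (A - B)) = 0"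
      unfolding GL_dist_def
      using onorm_pos_le[OF bl, of "A - B"] onorm_pos_le[OF bl, of "matrix_inv A - matrix_inv B"]
      by linarith
    then have "(A - B) *v v = 0" for v
      using onorm_eq_0[OF bl, of "A - B"] by blast
    then show "A = B"
      by (simp add: matrix_vector_mult_diff_rdistrib matrix_eq)
  next
    assume "A = B"
    then show "GL_dist A B = 0"
      by (simp add: GL_dist_def onorm_eq_0[OF bl])
  qed
  show "GL_dist A C \<le> GL_dist A B + GL_dist B C"
    unfolding GL_dist_def
    using tri[of A C B] tri[of "matrix_inv A" "matrix_inv C" "matrix_inv B"] by linarith
qed

definition GL_topology :: "(real^'m^'m) topology" where
  "GL_topology = Metric_space.mtopology GL GL_dist"

definition holder_GL :: "real \<Rightarrow> ('a::metric_space \<Rightarrow> real^'m^'m) \<Rightarrow> bool" where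
  "holder_GL \<alpha> A \<longleftrightarrow>
     range A \<subseteq> GL \<and> (\<exists>C. \<forall>x y. GL_dist (A x) (A y) \<le> C * dist x y powr \<alpha>)"

primrec cocycle_nat :: "('a \<Rightarrow> 'a) \<Rightarrow> ('a \<Rightarrow> real^'m^'m) \<Rightarrow> 'a \<Rightarrow> nat \<Rightarrow> real^'m^'m" where
  "cocycle_nat f A x 0 = mat 1"
| "cocycle_nat f A x (Suc n) = A ((f ^^ n) x) ** cocycle_nat f A x n"

definition cocycle :: "('a \<Rightarrow> 'a) \<Rightarrow> ('a \<Rightarrow> real^'m^'m) \<Rightarrow> 'a \<Rightarrow> int \<Rightarrow> real^'m^'m" where
  "cocycle f A x k =
     (if 0 \<le> k then cocycle_nat f A x (nat k)
      else matrix_inv (cocycle_nat f A (iterate f k x) (nat (- k))))"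

end

theory Submission
  imports Defs
begin

text \<open>
  Write \<open>A(x,n)\<close> for the product of the generator along \<open>x, f x, ..., f^(n-1) x\<close>. The plan is to
  compare \<open>A(x,n)\<close> with \<open>A(p,n)\<close>, where \<open>p\<close> is the periodic point that closes a nearly closed segment.
  If \<open>A(x,n)\<close> and its inverse grow more slowly than any exponential, the exponential closeness of the
  two orbits beats that growth, so \<open>A(x,n)\<close> stays within a constant factor of the bounded matrix
  \<open>A(p,n)\<close> (lemma \<open>closed_return_bound\<close>). Finitely many points of a dense orbit form a fine net of \<open>X\<close>;
  any transition along that orbit then factors into two nearly closed pieces and one piece of bounded
  length (lemma \<open>bounded_along_dense_orbit\<close>), and continuity extends the bound to all of \<open>X\<close>.

  The heart of the matter is that the growth is subexponential (lemma \<open>subexponential_growth\<close>).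
  Let \<open>w\<close> be the infimum of the rates \<open>r\<close> such that
  \<open>|A(x,n)| \<le> B exp (r n)\<close> for some \<open>B\<close> and all \<open>x\<close> and \<open>n\<close>, suppose \<open>w > 0\<close>, and take rates
  \<open>r < w < s\<close> that differ by much less than the closing exponent. Growth at rate \<open>s\<close> bounds every
  segment from above. Growth at rate \<open>r\<close> is exceeded by an arbitrarily large factor, so there are
  \<open>x\<close> and \<open>n\<close> for which the function \<open>i \<mapsto> ln |A(f^i x, n-i)| + r i\<close> drops by an arbitrarily large
  amount over \<open>[0,n]\<close>. As its single drops are bounded, it has many suffix maxima, that is,
  times \<open>i\<close> with \<open>|A(f^j x, n-j)| \<le> exp (-r (j-i)) |A(f^i x, n-i)|\<close> for all later \<open>j\<close>
  (lemma \<open>many_record_times\<close>). This condition concerns one time only, so by compactness and the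
  pigeonhole principle two such times \<open>i < j\<close> have \<open>f^i x\<close> and \<open>f^j x\<close> as close as desired, although the
  number of suffix maxima needed for that depends on the closeness. Let \<open>p\<close> close the segment from
  \<open>f^i x\<close> to \<open>f^j x\<close>, of length \<open>l\<close>. Replacing the matrices along \<open>x\<close> by those along \<open>p\<close> during the
  first \<open>T = (1 - 1/q) l\<close> steps changes \<open>A(f^i x, n-i)\<close> by at most half of its norm: the error made
  at step \<open>k\<close> is of relative size \<open>exp ((s - r) k)\<close> times a small multiple of the exponential closeness
  at step \<open>k\<close>, and the last \<open>l/q\<close> steps, where the closeness is too weak, are left out. Hence \<open>A(p,T)\<close>
  has norm at least \<open>exp (r T) / 2\<close>, and the remaining \<open>l/q\<close> steps can only undo a factor
  \<open>exp (\<Lambda> l / q)\<close>. For large \<open>q\<close> and \<open>l\<close> this contradicts the bound on \<open>A(p,l)\<close>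
  (lemma \<open>record_time_closing_bound\<close>).

  Statements about inverses come from the dual cocycle, generated by the transposed inverses of the
  generator: it satisfies the same hypotheses (lemma \<open>dual\<close>).
\<close>

section \<open>Operator norm and inverses of square matrices\<close>

abbreviation opnorm :: "real^'m^'m \<Rightarrow> real" where
  "opnorm M \<equiv> onorm ((*v) M)"

lemma opnorm_nonneg: "0 \<le> opnorm M"
  by (intro onorm_pos_le matrix_vector_mul_bounded_linear)

lemma opnorm_apply_le: "norm (M *v v) \<le> opnorm M * norm v"
  by (rule onorm[OF matrix_vector_mul_bounded_linear])

lemma opnorm_le: "(\<And>v. norm (M *v v) \<le> b * norm v) \<Longrightarrow> opnorm M \<le> b"
  by (rule onorm_le)

lemma opnorm_add_le: "opnorm (M + N) \<le> opnorm M + opnorm N"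
proof -
  have "(*v) (M + N) = (\<lambda>v. M *v v + N *v v)"
    by (simp add: fun_eq_iff matrix_vector_mult_add_rdistrib)
  then show ?thesis
    using onorm_triangle[of "(*v) M" "(*v) N"] by simp
qed

lemma opnorm_minus: "opnorm (- M) = opnorm M"
proof -
  have "(*v) (- M) = (\<lambda>v. - (M *v v))"
    using matrix_vector_mult_diff_rdistrib[of 0 M] by (simp add: fun_eq_iff)
  then show ?thesis
    using onorm_neg[of "(*v) M"] by simp
qed

lemma opnorm_minus_commute: "opnorm (M - N) = opnorm (N - M)"
  using opnorm_minus[of "M - N"] by simp

lemma opnorm_mult_le: "opnorm (M ** N) \<le> opnorm M * opnorm N"
  using onorm_compose[of "(*v) M" "(*v) N"]
  by (simp add: o_def matrix_vector_mul_assoc)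

lemma opnorm_mat1: "opnorm (mat 1 :: real^'m^'m) = 1"
proof -
  have "(*v) (mat 1 :: real^'m^'m) = (\<lambda>v. v)"
    by (simp add: fun_eq_iff)
  then show ?thesis
    by (simp add: onorm_id)
qed

lemma opnorm_transpose_le: "opnorm (transpose M) \<le> opnorm M"
proof (rule opnorm_le)
  fix v
  let ?w = "transpose M *v v"
  have "norm ?w * norm ?w = ?w \<bullet> ?w"
    by (simp add: power2_norm_eq_inner flip: power2_eq_square)
  also have "\<dots> = v \<bullet> (M *v ?w)"
    by (simp add: dot_lmul_matrix)
  also have "\<dots> \<le> norm v * norm (M *v ?w)"
    by (rule norm_cauchy_schwarz)
  also have "\<dots> \<le> norm v * (opnorm M * norm ?w)"
    by (intro mult_left_mono opnorm_apply_le norm_ge_zero)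
  finally have "norm ?w * norm ?w \<le> (opnorm M * norm v) * norm ?w"
    by (simp add: mult_ac)
  then show "norm ?w \<le> opnorm M * norm v"
    by (cases "norm ?w = 0") (auto simp: opnorm_nonneg mult_le_cancel_right)
qed

lemma opnorm_transpose: "opnorm (transpose M) = opnorm M"
  using opnorm_transpose_le[of M] opnorm_transpose_le[of "transpose M"]
  by (simp add: transpose_transpose)

text \<open>The library norm on matrices is the Euclidean norm of the entries; the next two lemmas transfer
  compactness and limits between it and the operator norm.\<close>

lemma norm_le_opnorm:
  fixes M :: "real^'m^'m"
  shows "norm M \<le> (real CARD('m))\<^sup>2 * opnorm M"
proof -
  have "norm M \<le> (\<Sum>i\<in>UNIV. norm (M $ i))"
    by (simp add: norm_vec_def L2_set_le_sum)
  also have "\<dots> \<le> (\<Sum>i\<in>(UNIV::'m set). \<Sum>j\<in>(UNIV::'m set). \<bar>M $ i $ j\<bar>)"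
    by (intro sum_mono norm_le_l1_cart)
  also have "\<dots> \<le> (\<Sum>i\<in>(UNIV::'m set). \<Sum>j\<in>(UNIV::'m set). opnorm M)"
    by (intro sum_mono matrix_component_le_onorm)
  finally show ?thesis
    by (simp add: power2_eq_square)
qed

lemma opnorm_le_norm:
  fixes M :: "real^'m^'m"
  shows "opnorm M \<le> (real CARD('m))\<^sup>2 * norm M"
proof -
  have "\<bar>M $ i $ j\<bar> \<le> norm M" for i j
    using component_le_norm_cart[of "M $ i" j] Finite_Cartesian_Product.norm_nth_le[of M i]
    by linarith
  then have "(\<Sum>i\<in>(UNIV::'m set). \<Sum>j\<in>(UNIV::'m set). \<bar>M $ i $ j\<bar>)
      \<le> (\<Sum>i\<in>(UNIV::'m set). \<Sum>j\<in>(UNIV::'m set). norm M)"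
    by (intro sum_mono)
  then show ?thesis
    using onorm_le_matrix_component_sum[of M] by (simp add: power2_eq_square)
qed

lemma matrix_mult_minus_right: "(M :: real^'m^'m) ** (N - P) = M ** N - M ** P"
  using matrix_add_ldistrib[of M "N - P" P] by (simp add: algebra_simps)

lemma matrix_mult_minus_left: "((N :: real^'m^'m) - P) ** M = N ** M - P ** M"
  by (simp add: matrix_matrix_mult_def vec_eq_iff sum_subtractf left_diff_distrib)

lemma
  fixes M :: "real^'m^'m"
  assumes "invertible M"
  shows matrix_inv_right: "M ** matrix_inv M = mat 1"
    and matrix_inv_left: "matrix_inv M ** M = mat 1"
proof -
  have "M ** matrix_inv M = mat 1 \<and> matrix_inv M ** M = mat 1"
    using assms unfolding matrix_inv_def invertible_def by (rule someI_ex)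
  then show "M ** matrix_inv M = mat 1" "matrix_inv M ** M = mat 1" by auto
qed

lemma matrix_inv_eqI:
  fixes M N :: "real^'m^'m"
  assumes "N ** M = mat 1"
  shows "matrix_inv M = N"
proof -
  have "invertible M"
    using assms invertible_left_inverse by blast
  then have "N ** (M ** matrix_inv M) = N"
    by (simp add: matrix_inv_right)
  then show ?thesis
    by (simp add: assms matrix_mul_assoc)
qed

lemma matrix_inv_inv: "invertible (M :: real^'m^'m) \<Longrightarrow> matrix_inv (matrix_inv M) = M"
  by (intro matrix_inv_eqI matrix_inv_right)

lemma invertible_matrix_inv: "invertible (M :: real^'m^'m) \<Longrightarrow> invertible (matrix_inv M)"
  using matrix_inv_right invertible_right_inverse invertible_left_inverse by blast

lemma matrix_inv_mult:
  fixes M N :: "real^'m^'m"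
  assumes "invertible M" "invertible N"
  shows "matrix_inv (M ** N) = matrix_inv N ** matrix_inv M"
proof (rule matrix_inv_eqI)
  have "matrix_inv N ** matrix_inv M ** (M ** N) = matrix_inv N ** (matrix_inv M ** M) ** N"
    by (simp add: matrix_mul_assoc)
  then show "matrix_inv N ** matrix_inv M ** (M ** N) = mat 1"
    using assms by (simp add: matrix_inv_left)
qed

lemma matrix_inv_transpose:
  fixes M :: "real^'m^'m"
  assumes "invertible M"
  shows "matrix_inv (transpose M) = transpose (matrix_inv M)"
  using assms by (intro matrix_inv_eqI) (simp flip: matrix_transpose_mul add: matrix_inv_right transpose_mat)

lemma matrix_inv_mat1: "matrix_inv (mat 1 :: real^'m^'m) = mat 1"
  by (rule matrix_inv_eqI) simp

lemma opnorm_mult_le_mult: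
  "opnorm M \<le> a \<Longrightarrow> opnorm N \<le> b \<Longrightarrow> opnorm (M ** N) \<le> a * b"
  by (meson mult_mono opnorm_mult_le opnorm_nonneg order_trans)

section \<open>Bounded and compact subsets of the general linear group\<close>

lemma compactin_GL_bounded:
  assumes "compactin GL_topology (K :: (real^'m^'m) set)"
  obtains Q where "Q > 0" "\<And>M. M \<in> K \<Longrightarrow> opnorm M \<le> Q \<and> opnorm (matrix_inv M) \<le> Q"
proof -
  interpret Metric_space "GL :: (real^'m^'m) set" GL_dist
    by (rule Metric_space_GL)
  obtain N B where KB: "K \<subseteq> mcball N B" 
    using compactin_imp_mbounded[of K] assms unfolding GL_topology_def mbounded_def by blast
  define Q where "Q = \<bar>B\<bar> + opnorm N + opnorm (matrix_inv N) + 1"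
  have "opnorm M \<le> Q \<and> opnorm (matrix_inv M) \<le> Q" if "M \<in> K" for M
  proof -
    have "GL_dist N M \<le> B"
      using KB that by auto
    then have "opnorm (M - N) + opnorm (matrix_inv M - matrix_inv N) \<le> B"
      by (metis GL_dist_def opnorm_minus_commute)
    moreover have "opnorm M \<le> opnorm (M - N) + opnorm N"
      "opnorm (matrix_inv M) \<le> opnorm (matrix_inv M - matrix_inv N) + opnorm (matrix_inv N)"
      using opnorm_add_le[of "M - N" N] opnorm_add_le[of "matrix_inv M - matrix_inv N" "matrix_inv N"]
      by auto
    moreover have "opnorm (M - N) \<ge> 0" "opnorm (matrix_inv M - matrix_inv N) \<ge> 0"
      "opnorm N \<ge> 0" "opnorm (matrix_inv N) \<ge> 0"
      by (simp_all add: opnorm_nonneg)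
    ultimately show ?thesis
      unfolding Q_def by linarith
  qed
  moreover have "Q > 0"
    using opnorm_nonneg[of N] opnorm_nonneg[of "matrix_inv N"] unfolding Q_def by linarith
  ultimately show ?thesis using that by blast
qed

lemma bounded_opnorm:
  fixes S :: "(real^'m^'m) set"
  assumes "\<And>M. M \<in> S \<Longrightarrow> opnorm M \<le> R"
  shows "bounded S"
  unfolding bounded_iff
proof (intro exI ballI)
  fix M assume "M \<in> S"
  then show "norm M \<le> (real CARD('m))\<^sup>2 * R"
    using norm_le_opnorm[of M] assms[of M] 
    by (meson mult_left_mono order_trans zero_le_power2)
qed

lemma tendsto_opnorm_diff:
  fixes M :: "nat \<Rightarrow> real^'m^'m"
  assumes "M \<longlonglongrightarrow> N"
  shows "(\<lambda>n. opnorm (M n - N)) \<longlonglongrightarrow> 0"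
proof (rule tendsto_sandwich[of "\<lambda>_. 0" _ _ "\<lambda>n. (real CARD('m))\<^sup>2 * norm (M n - N)"])
  have "(\<lambda>n. norm (M n - N)) \<longlonglongrightarrow> 0"
    using assms by (simp add: LIM_zero_iff tendsto_norm_zero_iff)
  then show "(\<lambda>n. (real CARD('m))\<^sup>2 * norm (M n - N)) \<longlonglongrightarrow> 0"
    by (rule tendsto_mult_right_zero)
  show "(\<lambda>_. 0::real) \<longlonglongrightarrow> 0" by simp
qed (auto simp: opnorm_nonneg opnorm_le_norm)

lemma opnorm_le_limit:
  fixes M :: "nat \<Rightarrow> real^'m^'m"
  assumes "M \<longlonglongrightarrow> N" "\<And>n. opnorm (M n) \<le> R"
  shows "opnorm N \<le> R"
proof -
  have "opnorm N \<le> opnorm (M n - N) + R" for n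
    using opnorm_add_le[of "N - M n" "M n"] assms(2)[of n]
    by (simp add: opnorm_minus_commute[of "M n"])
  moreover have "(\<lambda>n. opnorm (M n - N) + R) \<longlonglongrightarrow> 0 + R"
    by (intro tendsto_intros tendsto_opnorm_diff assms(1))
  ultimately show ?thesis
    using LIMSEQ_le_const[of "\<lambda>n. opnorm (M n - N) + R" "0 + R" "opnorm N"] by auto
qed

lemma tendsto_matrix_mult:
  fixes M N :: "'i \<Rightarrow> real^'m^'m"
  assumes "(M \<longlongrightarrow> P) F" "(N \<longlongrightarrow> Q) F"
  shows "((\<lambda>i. M i ** N i) \<longlongrightarrow> P ** Q) F"
  unfolding matrix_matrix_mult_def
  by (intro vec_tendstoI) (simp add: tendsto_sum tendsto_mult tendsto_vec_nth assms)

text \<open>In the space of all matrices a bound on the norm alone would allow singular limits. Passing to the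
  limit in the pair of a matrix and its inverse keeps the equation that makes the limit invertible.\<close>

lemma compactin_GL_opnorm_ball:
  "compactin GL_topology {M :: real^'m^'m. M \<in> GL \<and> opnorm M \<le> R \<and> opnorm (matrix_inv M) \<le> R}"
    (is "compactin _ ?S")
proof -
  interpret Metric_space "GL :: (real^'m^'m) set" GL_dist
    by (rule Metric_space_GL)
  have "\<exists>N r. N \<in> ?S \<and> strict_mono r \<and> limitin mtopology (\<sigma> \<circ> r) N sequentially"
    if \<sigma>: "range \<sigma> \<subseteq> ?S" for \<sigma> :: "nat \<Rightarrow> real^'m^'m"
  proof -
    have \<sigma>GL: "\<sigma> n \<in> GL" for n
      using \<sigma> by auto
    then have inv\<sigma>: "invertible (\<sigma> n)" and b: "opnorm (\<sigma> n) \<le> R" "opnorm (matrix_inv (\<sigma> n)) \<le> R" for n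
      using \<sigma> by (auto simp: GL_def image_subset_iff)
    define \<tau> where "\<tau> n = (\<sigma> n, matrix_inv (\<sigma> n))" for n
    have "bounded (range \<sigma> \<times> range (\<lambda>n. matrix_inv (\<sigma> n)))"
      using b by (intro bounded_Times bounded_opnorm[of _ R]) auto
    then have "bounded (range \<tau>)"
      by (rule bounded_subset) (auto simp: \<tau>_def)
    then obtain l r where r: "strict_mono r" and l: "(\<tau> \<circ> r) \<longlonglongrightarrow> l"
      using bounded_imp_convergent_subsequence by blast
    define N N' where "N = fst l" and "N' = snd l"
    have N: "(\<lambda>n. \<sigma> (r n)) \<longlonglongrightarrow> N" and N': "(\<lambda>n. matrix_inv (\<sigma> (r n))) \<longlonglongrightarrow> N'"
      using tendsto_fst[OF l] tendsto_snd[OF l] by (simp_all add: \<tau>_def N_def N'_def o_def)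
    have "(\<lambda>n. matrix_inv (\<sigma> (r n)) ** \<sigma> (r n)) \<longlonglongrightarrow> N' ** N"
      by (intro tendsto_matrix_mult N N')
    then have NN: "N' ** N = mat 1"
      by (simp add: matrix_inv_left[OF inv\<sigma>] LIMSEQ_const_iff)
    have inv: "matrix_inv N = N'"
      by (rule matrix_inv_eqI[OF NN])
    have NS: "N \<in> ?S"
      using NN invertible_left_inverse opnorm_le_limit[OF N b(1)] opnorm_le_limit[OF N' b(2)] inv
      by (auto simp: GL_def)
    have "(\<lambda>n. GL_dist (\<sigma> (r n)) N) \<longlonglongrightarrow> 0"
      unfolding GL_dist_def inv
      using tendsto_add[OF tendsto_opnorm_diff[OF N] tendsto_opnorm_diff[OF N']] by simp
    then have "limitin mtopology (\<sigma> \<circ> r) N sequentially"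
      using NS \<sigma>GL by (auto simp: limitin_metric_dist_null o_def)
    with NS r show ?thesis by blast
  qed
  then show ?thesis
    unfolding GL_topology_def compactin_sequentially by blast
qed

lemma holder_GL_bounded:
  fixes A :: "'a::metric_space \<Rightarrow> real^'m^'m"
  assumes "compact (UNIV :: 'a set)" "\<alpha> > 0" "holder_GL \<alpha> A"
  obtains H \<Lambda> where "H \<ge> 0" "\<Lambda> > 0"
    "\<And>x y. GL_dist (A x) (A y) \<le> H * dist x y powr \<alpha>"
    "\<And>x. opnorm (A x) \<le> exp \<Lambda>" "\<And>x. opnorm (matrix_inv (A x)) \<le> exp \<Lambda>"
proof -
  obtain C where C: "\<And>x y. GL_dist (A x) (A y) \<le> C * dist x y powr \<alpha>"
    using assms(3) by (auto simp: holder_GL_def)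
  define H where "H = \<bar>C\<bar>"
  have H: "GL_dist (A x) (A y) \<le> H * dist x y powr \<alpha>" for x y
    using C[of x y] mult_right_mono[of C H "dist x y powr \<alpha>"] by (simp add: H_def abs_ge_self)
  define D where "D = diameter (UNIV :: 'a set)"
  have D: "dist x y \<le> D" for x y :: 'a
    unfolding D_def using diameter_bounded_bound[OF compact_imp_bounded[OF assms(1)]] by auto
  define x0 :: 'a where "x0 = undefined"
  define L where "L = H * D powr \<alpha> + opnorm (A x0) + opnorm (matrix_inv (A x0)) + 1"
  have L: "opnorm (A x) \<le> L \<and> opnorm (matrix_inv (A x)) \<le> L" for x
  proof -
    have "dist x x0 powr \<alpha> \<le> D powr \<alpha>"
      using D assms(2) by (intro powr_mono2) auto
    then have "H * dist x x0 powr \<alpha> \<le> H * D powr \<alpha>"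
      by (intro mult_left_mono) (auto simp: H_def)
    then have "opnorm (A x - A x0) + opnorm (matrix_inv (A x) - matrix_inv (A x0)) \<le> H * D powr \<alpha>"
      using H[of x x0] by (simp add: GL_dist_def)
    then show ?thesis
      unfolding L_def
      using opnorm_add_le[of "A x - A x0" "A x0"]
        opnorm_add_le[of "matrix_inv (A x) - matrix_inv (A x0)" "matrix_inv (A x0)"]
        opnorm_nonneg[of "A x - A x0"] opnorm_nonneg[of "matrix_inv (A x) - matrix_inv (A x0)"]
        opnorm_nonneg[of "A x0"] opnorm_nonneg[of "matrix_inv (A x0)"] by auto
  qed
  have "L \<ge> 0"
    using L[of x0] opnorm_nonneg[of "A x0"] by linarith
  then have "L \<le> exp (L + 1)"
    using exp_ge_add_one_self[of "L + 1"] by linarith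
  then have "opnorm (A x) \<le> exp (L + 1)" "opnorm (matrix_inv (A x)) \<le> exp (L + 1)" for x
    using L[of x] by linarith+
  then show ?thesis
    using H \<open>L \<ge> 0\<close> by (intro that[of H "L + 1"]) (auto simp: H_def)
qed

section \<open>Comparing two products of matrices\<close>

text \<open>The quantity \<open>P k ** R k\<close> is a product whose first \<open>k\<close> factors have been exchanged from \<open>a\<close> to \<open>b\<close>,
  so exchanging one factor at a time gives a telescoping sum. Depending on which of \<open>P\<close> and \<open>R\<close> are
  inverses, this compares a product with a product, or a quotient of products with the identity.\<close>

lemma opnorm_telescope:
  fixes P R a b :: "nat \<Rightarrow> real^'m^'m"
  assumes "\<And>k. k < T \<Longrightarrow> P k = P (Suc k) ** a k"
    and "\<And>k. k < T \<Longrightarrow> R (Suc k) = b k ** R k"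
  shows "opnorm (P T ** R T - P 0 ** R 0)
    \<le> (\<Sum>k<T. opnorm (P (Suc k)) * opnorm (a k - b k) * opnorm (R k))"
  using assms
proof (induction T)
  case 0
  then show ?case using opnorm_mult_le[of 0 0] by (simp add: onorm_zero)
next
  case (Suc T)
  have "P (Suc T) ** R (Suc T) - P T ** R T = P (Suc T) ** (b T - a T) ** R T"
    using Suc.prems by (simp add: matrix_mult_minus_right matrix_mult_minus_left matrix_mul_assoc)
  then have "opnorm (P (Suc T) ** R (Suc T) - P T ** R T)
      \<le> opnorm (P (Suc T)) * opnorm (a T - b T) * opnorm (R T)"
    by (simp add: opnorm_mult_le_mult opnorm_minus_commute[of "a T"])
  moreover have "opnorm (P T ** R T - P 0 ** R 0)
      \<le> (\<Sum>k<T. opnorm (P (Suc k)) * opnorm (a k - b k) * opnorm (R k))"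
    using Suc by simp
  moreover have "opnorm (P (Suc T) ** R (Suc T) - P 0 ** R 0)
      \<le> opnorm (P (Suc T) ** R (Suc T) - P T ** R T) + opnorm (P T ** R T - P 0 ** R 0)"
    using opnorm_add_le[of "P (Suc T) ** R (Suc T) - P T ** R T" "P T ** R T - P 0 ** R 0"]
    by simp
  ultimately show ?case by simp
qed

section \<open>Suffix maxima, geometric sums and small distances\<close>

text \<open>Read from right to left, a suffix maximum sets a new record, and each record improves on the
  previous one by at most \<open>\<Lambda>\<close>; so a total drop from \<open>h 0\<close> to \<open>h n\<close> needs many of them. This is the
  combinatorial core of Pliss's lemma.\<close>

lemma card_suffix_maxima_ge:
  fixes h :: "nat \<Rightarrow> real"
  assumes "0 \<le> \<Lambda>"
    and step: "\<And>i. i < n \<Longrightarrow> h i \<le> h (Suc i) + \<Lambda>"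
  shows "h 0 \<le> h n + \<Lambda> * card {i. i \<le> n \<and> (\<forall>j. i \<le> j \<and> j \<le> n \<longrightarrow> h j \<le> h i)}"
proof -
  define R where "R i = {k. i \<le> k \<and> k \<le> n \<and> (\<forall>j. k \<le> j \<and> j \<le> n \<longrightarrow> h j \<le> h k)}" for i
  have fin: "finite (R i)" for i
    by (rule finite_subset[of _ "{..n}"]) (auto simp: R_def)
  have "\<forall>j. i \<le> j \<and> j \<le> n \<longrightarrow> h j \<le> h n + \<Lambda> * card (R i)" if "i \<le> n" for i
    using that
  proof (induction i rule: inc_induct)
    case base
    then show ?case using assms(1) by auto
  next
    case (step i)
    have mono: "R (Suc i) \<subseteq> R i"
      by (auto simp: R_def)
    then have le: "\<Lambda> * card (R (Suc i)) \<le> \<Lambda> * card (R i)"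
      using assms(1) fin by (intro mult_left_mono) (auto intro: card_mono)
    have IH: "h j \<le> h n + \<Lambda> * card (R (Suc i))" if "Suc i \<le> j" "j \<le> n" for j
      using step that by auto
    have "h i \<le> h n + \<Lambda> * card (R i)"
    proof (cases "\<forall>j. i \<le> j \<and> j \<le> n \<longrightarrow> h j \<le> h i")
      case True
      then have "insert i (R (Suc i)) \<subseteq> R i"
        using mono step by (auto simp: R_def)
      then have "card (insert i (R (Suc i))) \<le> card (R i)"
        using fin card_mono by blast
      moreover have "i \<notin> R (Suc i)"
        by (auto simp: R_def)
      ultimately have "real (card (R (Suc i))) + 1 \<le> real (card (R i))"
        using fin by simp
      then have "\<Lambda> * (real (card (R (Suc i))) + 1) \<le> \<Lambda> * real (card (R i))"
        using assms(1) by (rule mult_left_mono)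
      moreover have "h i \<le> h (Suc i) + \<Lambda>" "h (Suc i) \<le> h n + \<Lambda> * card (R (Suc i))"
        using step IH assms(2) by auto
      ultimately show ?thesis by (simp add: algebra_simps)
    next
      case False
      then obtain j where "i \<le> j" "j \<le> n" "h i < h j"
        by auto
      moreover from this have "Suc i \<le> j"
        by (metis less_irrefl not_less_eq_eq order_antisym)
      ultimately show ?thesis using IH[of j] le by linarith
    qed
    moreover have "h j \<le> h n + \<Lambda> * card (R i)" if "Suc i \<le> j" "j \<le> n" for j
      using IH[OF that] le by linarith
    ultimately show ?case
      by (metis le_antisym not_less_eq_eq)
  qed
  from this[of 0] show ?thesis
    by (simp add: R_def)
qed

lemma sum_exp_le:
  fixes \<gamma> :: real
  assumes "\<gamma> > 0"
  shows "(\<Sum>k<T. exp (- \<gamma> * real k)) \<le> 1 / (1 - exp (- \<gamma>))"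
proof -
  have "(\<Sum>k<T. exp (- \<gamma> * real k)) = (\<Sum>k<T. exp (- \<gamma>) ^ k)"
    by (simp add: mult.commute flip: exp_of_nat_mult)
  also have "\<dots> \<le> (\<Sum>k. exp (- \<gamma>) ^ k)"
    using assms by (intro sum_le_suminf summable_geometric) auto
  also have "\<dots> = 1 / (1 - exp (- \<gamma>))"
    using assms by (intro suminf_geometric) auto
  finally show ?thesis .
qed

text \<open>Here \<open>t\<close> stands for the distance between the ends of an orbit segment, and \<open>B\<close> collects the
  constants of an estimate that compares the segment with a periodic one.\<close>

lemma small_distances:
  fixes B c \<alpha> \<delta>\<^sub>0 :: real
  assumes "B \<ge> 0" "c > 0" "\<alpha> > 0" "\<delta>\<^sub>0 > 0"
  obtains \<delta> where "\<delta> > 0" "\<delta> \<le> \<delta>\<^sub>0" "\<And>t. 0 \<le> t \<Longrightarrow> t < \<delta> \<Longrightarrow> B * (c * t) powr \<alpha> \<le> 1 / 2"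
proof -
  define u where "u = (1 / (2 * (B + 1))) powr (1 / \<alpha>)"
  have u: "u > 0" "u powr \<alpha> = 1 / (2 * (B + 1))"
    using assms by (auto simp: u_def powr_powr)
  show ?thesis
  proof (rule that[of "min \<delta>\<^sub>0 (u / c)"])
    show "min \<delta>\<^sub>0 (u / c) > 0" "min \<delta>\<^sub>0 (u / c) \<le> \<delta>\<^sub>0"
      using assms u by auto
    fix t assume t: "0 \<le> t" "t < min \<delta>\<^sub>0 (u / c)"
    then have "c * t \<le> u"
      using assms by (simp add: field_simps)
    then have "(c * t) powr \<alpha> \<le> 1 / (2 * (B + 1))"
      using assms t powr_mono2[of \<alpha> "c * t" u] u by auto
    then have "B * (c * t) powr \<alpha> \<le> B * (1 / (2 * (B + 1)))"
      using assms(1) by (rule mult_left_mono)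
    also have "\<dots> \<le> 1 / 2"
      using assms(1) by (simp add: field_simps)
    finally show "B * (c * t) powr \<alpha> \<le> 1 / 2" .
  qed
qed

section \<open>Invertible cocycles\<close>

lemma cocycle_nat_add:
  "cocycle_nat f A x (m + n) = cocycle_nat f A ((f ^^ m) x) n ** cocycle_nat f A x m"
  by (induction n) (simp_all add: matrix_mul_assoc funpow_add add.commute[of m])

locale invertible_cocycle =
  fixes f :: "'a \<Rightarrow> 'a" and A :: "'a \<Rightarrow> real^'m^'m"
  assumes invertible_A: "invertible (A x)"
begin

abbreviation "C \<equiv> cocycle_nat f A"
abbreviation "Ci x n \<equiv> matrix_inv (cocycle_nat f A x n)"

lemma invertible_C: "invertible (C x n)"
proof (induction n)
  case 0
  show ?case using invertible_left_inverse[of "mat 1 :: real^'m^'m"] matrix_mul_lid by auto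
qed (simp add: invertible_A invertible_mult)

lemma dual_cocycle_nat:
  "cocycle_nat f (\<lambda>x. transpose (matrix_inv (A x))) x n = transpose (Ci x n)"
  by (induction n)
    (simp_all add: matrix_inv_mat1 transpose_mat matrix_inv_mult invertible_A invertible_C
      matrix_transpose_mul)

lemma opnorm_C_pos: "opnorm (C x n) > 0"
proof -
  have "1 \<le> opnorm (C x n) * opnorm (Ci x n)"
    using opnorm_mult_le[of "C x n" "Ci x n"]
    by (simp add: matrix_inv_right[OF invertible_C] opnorm_mat1)
  then show ?thesis
    using opnorm_nonneg[of "C x n"] opnorm_nonneg[of "Ci x n"]
    by (metis less_eq_real_def mult_zero_left not_one_le_zero)
qed

lemma C_split: "i \<le> n \<Longrightarrow> C x n = C ((f ^^ i) x) (n - i) ** C x i"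
  using cocycle_nat_add[of f A x i "n - i"] by simp

lemma C_split_first: "i < n \<Longrightarrow> C ((f ^^ i) x) (n - i) = C ((f ^^ Suc i) x) (n - Suc i) ** A ((f ^^ i) x)"
  using C_split[of 1 "n - i" "(f ^^ i) x"] by simp

lemma C_eq_Ci_mult: "i \<le> n \<Longrightarrow> C x i = Ci ((f ^^ i) x) (n - i) ** C x n"
  using C_split[of i n x] matrix_inv_left[OF invertible_C, of "(f ^^ i) x" "n - i"]
  by (simp add: matrix_mul_assoc)

end

lemma iterate_add_nat:
  assumes "bij f"
  shows "(f ^^ n) (iterate f k z) = iterate f (k + int n) z"
proof (induction n)
  case (Suc n)
  have step: "f (iterate f j z) = iterate f (j + 1) z" for j
  proof (cases "0 \<le> j")
    case True
    then show ?thesis by (simp add: iterate_def nat_add_distrib)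
  next
    case False
    then have "nat (- j) = Suc (nat (- (j + 1)))"
      by simp
    then show ?thesis
      using False assms by (simp add: iterate_def bij_is_surj surj_f_inv_f)
  qed
  show ?case by (simp add: Suc step algebra_simps)
qed simp

lemma continuous_cocycle_nat:
  assumes "continuous_on UNIV f" "continuous_on UNIV A"
  shows "continuous_on UNIV (\<lambda>x. cocycle_nat f A x n)"
proof (induction n)
  case (Suc n)
  have fn: "continuous_on UNIV (f ^^ k)" for k
    by (induction k) (auto simp: o_def intro: continuous_on_compose2[OF assms(1)])
  have "continuous_on UNIV (\<lambda>x. A ((f ^^ n) x))"
    by (rule continuous_on_compose2[OF assms(2) fn]) auto
  then show ?case
    using Suc by (simp add: continuous_on_def tendsto_matrix_mult)
qed simp

section \<open>Bounded periodic data and the dual cocycle\<close>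

text \<open>All hypotheses come in pairs, one for the generator and one for its inverse, so that the dual
  cocycle is again an instance with the same constants.\<close>

locale bounded_periodic_cocycle = invertible_cocycle f A
  for f :: "'a::metric_space \<Rightarrow> 'a" and A :: "'a \<Rightarrow> real^'m^'m" +
  fixes c lam \<delta>\<^sub>0 \<alpha> H \<Lambda> Q :: real
  assumes compact: "compact (UNIV :: 'a set)"
    and pos: "c > 0" "lam > 0" "\<delta>\<^sub>0 > 0" "\<alpha> > 0" "H \<ge> 0" "\<Lambda> > 0" "Q > 0"
    and closing: "n > 0 \<Longrightarrow> dist x ((f ^^ n) x) < \<delta>\<^sub>0 \<Longrightarrow>
      \<exists>p. (f ^^ n) p = p \<and> exponentially_close f lam (c * dist x ((f ^^ n) x)) n x p"
    and A_le: "opnorm (A x) \<le> exp \<Lambda>"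
    and A_inv_le: "opnorm (matrix_inv (A x)) \<le> exp \<Lambda>"
    and A_holder: "opnorm (A x - A y) \<le> H * dist x y powr \<alpha>"
    and A_inv_holder: "opnorm (matrix_inv (A x) - matrix_inv (A y)) \<le> H * dist x y powr \<alpha>"
    and periodic_le: "n > 0 \<Longrightarrow> (f ^^ n) p = p \<Longrightarrow> opnorm (cocycle_nat f A p n) \<le> Q"
    and periodic_inv_le:
      "n > 0 \<Longrightarrow> (f ^^ n) p = p \<Longrightarrow> opnorm (matrix_inv (cocycle_nat f A p n)) \<le> Q"
begin

text \<open>Inversion reverses the order of products and transposition restores it, so transposed inverses
  form a cocycle over the same map; transposition preserves the operator norm.\<close>

lemma dual:
  "bounded_periodic_cocycle f (\<lambda>x. transpose (matrix_inv (A x))) c lam \<delta>\<^sub>0 \<alpha> H \<Lambda> Q"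
proof
  have diff: "transpose M - transpose N = transpose (M - N)" for M N :: "real^'m^'m"
    by (simp add: transpose_def vec_eq_iff)
  note inv = matrix_inv_transpose matrix_inv_inv invertible_matrix_inv invertible_A invertible_C
  show "invertible (transpose (matrix_inv (A x)))" for x
    by (simp add: inv transpose_invertible)
  show "opnorm (transpose (matrix_inv (A x))) \<le> exp \<Lambda>"
    "opnorm (matrix_inv (transpose (matrix_inv (A x)))) \<le> exp \<Lambda>" for x
    using A_le[of x] A_inv_le[of x] by (simp_all add: opnorm_transpose inv)
  show "opnorm (transpose (matrix_inv (A x)) - transpose (matrix_inv (A y))) \<le> H * dist x y powr \<alpha>"
    "opnorm (matrix_inv (transpose (matrix_inv (A x))) - matrix_inv (transpose (matrix_inv (A y))))
      \<le> H * dist x y powr \<alpha>" for x y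
    using A_holder[of x y] A_inv_holder[of x y] by (simp_all add: diff opnorm_transpose inv)
  show "opnorm (cocycle_nat f (\<lambda>x. transpose (matrix_inv (A x))) p n) \<le> Q"
    "opnorm (matrix_inv (cocycle_nat f (\<lambda>x. transpose (matrix_inv (A x))) p n)) \<le> Q"
    if "n > 0" "(f ^^ n) p = p" for p n
    using periodic_le[OF that] periodic_inv_le[OF that]
    unfolding dual_cocycle_nat by (simp_all add: opnorm_transpose inv)
qed (use compact pos closing in auto)

lemma C_le: "opnorm (C x n) \<le> exp (\<Lambda> * n)"
proof (induction n)
  case (Suc n)
  have "opnorm (C x (Suc n)) \<le> exp \<Lambda> * exp (\<Lambda> * n)"
    by (simp add: opnorm_mult_le_mult A_le Suc)
  then show ?case by (simp add: algebra_simps flip: exp_add)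
qed (simp add: onorm_id)

lemma Ci_le: "opnorm (Ci x n) \<le> exp (\<Lambda> * n)"
proof -
  interpret dual: bounded_periodic_cocycle f "\<lambda>x. transpose (matrix_inv (A x))" c lam \<delta>\<^sub>0 \<alpha> H \<Lambda> Q
    by (rule dual)
  show ?thesis
    using dual.C_le[of x n] by (simp add: dual_cocycle_nat opnorm_transpose)
qed

lemma closing_orbit:
  assumes "n > 0" "dist x ((f ^^ n) x) < \<delta>\<^sub>0"
  obtains p where "(f ^^ n) p = p"
    "\<And>k. k \<le> n \<Longrightarrow> opnorm (A ((f ^^ k) x) - A ((f ^^ k) p))
      \<le> H * (c * dist x ((f ^^ n) x)) powr \<alpha> * exp (- (\<alpha> * lam) * min k (n - k))"
proof -
  define t where "t = c * dist x ((f ^^ n) x)"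
  obtain p where p: "(f ^^ n) p = p" and ec: "exponentially_close f lam t n x p"
    using closing[OF assms] unfolding t_def by blast
  have "t \<ge> 0"
    using pos by (simp add: t_def)
  have "opnorm (A ((f ^^ k) x) - A ((f ^^ k) p))
      \<le> H * t powr \<alpha> * exp (- (\<alpha> * lam) * min k (n - k))" if "k \<le> n" for k
  proof -
    have "dist ((f ^^ k) x) ((f ^^ k) p) powr \<alpha> \<le> (t * exp (- lam * min k (n - k))) powr \<alpha>"
      using ec that pos by (intro powr_mono2) (auto simp: exponentially_close_def)
    also have "\<dots> = t powr \<alpha> * exp (- (\<alpha> * lam) * min k (n - k))"
      using \<open>t \<ge> 0\<close> by (simp add: powr_mult exp_powr_real mult_ac)
    finally have "H * dist ((f ^^ k) x) ((f ^^ k) p) powr \<alpha>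
        \<le> H * (t powr \<alpha> * exp (- (\<alpha> * lam) * min k (n - k)))"
      using pos(5) by (rule mult_left_mono)
    then show ?thesis
      using A_holder[of "(f ^^ k) x" "(f ^^ k) p"] by (simp add: mult.assoc)
  qed
  with p show ?thesis
    unfolding t_def by (rule that)
qed

section \<open>Subexponential growth\<close>

text \<open>The times in \<open>G\<close> are the suffix maxima of \<open>ln |A(f^i x, n-i)| + r i\<close>. The endpoint \<open>n\<close> is the same
  for all of them, which makes membership in \<open>G\<close> a property of a single time.\<close>

lemma many_record_times:
  assumes "0 \<le> r" and unbounded: "\<And>B. \<exists>x n. B * exp (r * real n) < opnorm (C x n)"
  obtains x n G where "G \<subseteq> {..n}" "m < card G"
    "\<And>i j. i \<in> G \<Longrightarrow> i \<le> j \<Longrightarrow> j \<le> n \<Longrightarrow>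
      opnorm (C ((f ^^ j) x) (n - j)) \<le> exp (- r * real (j - i)) * opnorm (C ((f ^^ i) x) (n - i))"
proof -
  \<comment> \<open>The factor makes \<open>h\<close> below drop by more than \<open>\<Lambda> * m\<close>.\<close>
  obtain x n where xn: "exp (\<Lambda> * m) * exp (r * real n) < opnorm (C x n)"
    using unbounded by blast
  define h where "h i = ln (opnorm (C ((f ^^ i) x) (n - i))) + r * real i" for i
  define G where "G = {i. i \<le> n \<and> (\<forall>j. i \<le> j \<and> j \<le> n \<longrightarrow> h j \<le> h i)}"
  have step: "h i \<le> h (Suc i) + \<Lambda>" if "i < n" for i
  proof -
    have "opnorm (C ((f ^^ i) x) (n - i)) \<le> opnorm (C ((f ^^ Suc i) x) (n - Suc i)) * exp \<Lambda>"
      unfolding C_split_first[OF that] by (intro opnorm_mult_le_mult order_refl A_le)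
    then have "ln (opnorm (C ((f ^^ i) x) (n - i)))
        \<le> ln (opnorm (C ((f ^^ Suc i) x) (n - Suc i)) * exp \<Lambda>)"
      using opnorm_C_pos by (intro ln_mono) auto
    also have "\<dots> = ln (opnorm (C ((f ^^ Suc i) x) (n - Suc i))) + \<Lambda>"
      using opnorm_C_pos[of "(f ^^ Suc i) x" "n - Suc i"] by (subst ln_mult) auto
    finally show ?thesis
      using assms(1) by (simp add: h_def algebra_simps)
  qed
  have "h 0 \<le> h n + \<Lambda> * card G"
    unfolding G_def using pos step by (intro card_suffix_maxima_ge) auto
  moreover have "h n = r * n"
    by (simp add: h_def opnorm_mat1)
  moreover have "\<Lambda> * m + r * n < h 0"
  proof -
    have "ln (exp (\<Lambda> * m + r * real n)) < ln (opnorm (C x n))"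
      using xn opnorm_C_pos[of x n] by (subst ln_less_cancel_iff) (auto simp: exp_add)
    then show ?thesis by (simp add: h_def)
  qed
  ultimately have "\<Lambda> * real m < \<Lambda> * real (card G)"
    by linarith
  then have "m < card G"
    using pos(6) by simp
  moreover have "opnorm (C ((f ^^ j) x) (n - j))
      \<le> exp (- r * real (j - i)) * opnorm (C ((f ^^ i) x) (n - i))"
    if "i \<in> G" "i \<le> j" "j \<le> n" for i j
  proof -
    let ?a = "\<lambda>i. opnorm (C ((f ^^ i) x) (n - i))"
    have "h j \<le> h i"
      using that by (auto simp: G_def)
    then have "ln (?a j) \<le> - r * real (j - i) + ln (?a i)"
      using that by (simp add: h_def of_nat_diff algebra_simps)
    then have "exp (ln (?a j)) \<le> exp (- r * real (j - i) + ln (?a i))"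
      by (rule exp_le_cancel_iff[THEN iffD2])
    then show ?thesis
      by (simp only: exp_add exp_ln opnorm_C_pos)
  qed
  ultimately show ?thesis
    by (intro that[of G n x]) (auto simp: G_def)
qed

text \<open>If an orbit segment of length \<open>q * d\<close> starts at a record time and nearly closes, then the periodic
  point that closes it inherits growth at rate \<open>r\<close> during the first \<open>(q - 1) * d\<close> steps; the bounded
  return matrix forces the last \<open>d\<close> steps to undo it. Note that \<open>n\<close> may exceed the length of the
  segment: the comparison is carried out inside the long product up to \<open>n\<close>, so \<open>\<delta>\<close> depends neither
  on \<open>n\<close> nor on where the segment ends.\<close>

lemma record_time_closing_bound:
  assumes r: "0 \<le> r" and s: "\<And>x n. opnorm (C x n) \<le> B * exp (s * real n)"
    and q: "q > 0" and gap: "s - r \<le> \<alpha> * lam / (2 * real q)"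
  obtains \<delta> where "\<delta> > 0"
    "\<And>x n d. d > 0 \<Longrightarrow> q * d \<le> n \<Longrightarrow> dist x ((f ^^ (q * d)) x) < \<delta> \<Longrightarrow>
      (\<And>j. j \<le> n \<Longrightarrow> opnorm (C ((f ^^ j) x) (n - j)) \<le> exp (- r * real j) * opnorm (C x n)) \<Longrightarrow>
      exp (r * real ((q - 1) * d)) \<le> 2 * Q * exp (\<Lambda> * real d)"
proof -
  define \<gamma> where "\<gamma> = \<alpha> * lam / (2 * real q)"
  have \<gamma>: "\<gamma> > 0"
    using pos q by (simp add: \<gamma>_def)
  define S where "S = 1 / (1 - exp (- \<gamma>))"
  have S: "S > 0"
    using \<gamma> by (simp add: S_def)
  have "opnorm (C undefined 0) \<le> B"
    using s[of undefined 0] by simp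
  then have B: "B \<ge> 0"
    using opnorm_nonneg order_trans by blast
  obtain \<delta> where \<delta>: "\<delta> > 0" "\<delta> \<le> \<delta>\<^sub>0"
    and small: "\<And>t. 0 \<le> t \<Longrightarrow> t < \<delta> \<Longrightarrow> (B * H * S) * (c * t) powr \<alpha> \<le> 1 / 2"
    using small_distances[of "B * H * S" c \<alpha> \<delta>\<^sub>0] B S pos
    by (metis less_imp_le mult_nonneg_nonneg)
  have "exp (r * real ((q - 1) * d)) \<le> 2 * Q * exp (\<Lambda> * real d)"
    if d: "d > 0" and qd: "q * d \<le> n" and close: "dist x ((f ^^ (q * d)) x) < \<delta>"
      and good: "\<And>j. j \<le> n \<Longrightarrow>
        opnorm (C ((f ^^ j) x) (n - j)) \<le> exp (- r * real j) * opnorm (C x n)" for x n d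
  proof -
    define l T where "l = q * d" and "T = (q - 1) * d"
    have lT: "l = T + d" "T \<le> n" "l > 0"
      using q d qd by (auto simp: l_def T_def algebra_simps simp flip: mult_Suc)
    define \<tau> where "\<tau> = (c * dist x ((f ^^ l) x)) powr \<alpha>"
    have \<tau>: "0 \<le> \<tau>" "B * H * S * \<tau> \<le> 1 / 2"
      using small[of "dist x ((f ^^ l) x)"] close by (auto simp: \<tau>_def l_def)
    have "dist x ((f ^^ l) x) < \<delta>\<^sub>0"
      using close \<delta>(2) by (simp add: l_def)
    from closing_orbit[OF lT(3) this]
    obtain p where p: "(f ^^ l) p = p" and pA: "\<And>k. k \<le> l \<Longrightarrow>
        opnorm (A ((f ^^ k) x) - A ((f ^^ k) p)) \<le> H * \<tau> * exp (- (\<alpha> * lam) * min k (l - k))"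
      unfolding \<tau>_def by blast
    define P where "P k = C ((f ^^ k) x) (n - k)" for k
    have P0: "opnorm (P 0) > 0"
      by (simp add: P_def opnorm_C_pos)
    have P: "opnorm (P k) \<le> exp (- r * real k) * opnorm (P 0)" if "k \<le> n" for k
      using good[OF that] by (simp add: P_def)
    have term_le: "opnorm (P (Suc k)) * opnorm (A ((f ^^ k) x) - A ((f ^^ k) p)) * opnorm (C p k)
        \<le> opnorm (P 0) * B * H * \<tau> * exp (- \<gamma> * real k)" if "k < T" for k
    proof -
      \<comment> \<open>As the last \<open>d\<close> steps are excluded, the closeness at step \<open>k\<close> is exponential in \<open>k / q\<close>
        throughout; the hypothesis on \<open>s - r\<close> makes this win over the loss \<open>(s - r) * k\<close>.\<close>
      have "k \<le> q * min k (l - k)"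
      proof -
        have "k \<le> q * d"
          using that lT(1) by (auto simp: l_def)
        also have "\<dots> \<le> q * (l - k)"
          using that lT(1) by (intro mult_left_mono) auto
        finally show ?thesis
          using q by (cases "k \<le> l - k") auto
      qed
      then have "real k \<le> real q * real (min k (l - k))"
        by (metis of_nat_le_iff of_nat_mult)
      then have "2 * \<gamma> * real k \<le> 2 * \<gamma> * (real q * real (min k (l - k)))"
        using \<gamma> by (intro mult_left_mono) auto
      also have "\<dots> = \<alpha> * lam * real (min k (l - k))"
        using q by (simp add: \<gamma>_def)
      finally have e1: "2 * \<gamma> * real k \<le> \<alpha> * lam * real (min k (l - k))" .
      have e2: "(s - r) * real k \<le> \<gamma> * real k"
        using gap by (intro mult_right_mono) (auto simp: \<gamma>_def)
      have e3: "- r * real (Suc k) \<le> - r * real k"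
        using r by (simp add: algebra_simps)
      have "opnorm (P (Suc k)) * opnorm (A ((f ^^ k) x) - A ((f ^^ k) p)) * opnorm (C p k)
        \<le> (exp (- r * real (Suc k)) * opnorm (P 0)) * (H * \<tau> * exp (- (\<alpha> * lam) * min k (l - k)))
          * (B * exp (s * real k))"
        using P[of "Suc k"] pA[of k] s[of p k] that lT P0 pos \<tau>
        by (intro mult_mono mult_nonneg_nonneg opnorm_nonneg) auto
      also have "\<dots> = opnorm (P 0) * B * H * \<tau>
          * exp (- r * real (Suc k) + - (\<alpha> * lam) * min k (l - k) + s * real k)"
        by (simp only: exp_add mult_ac)
      also have "\<dots> \<le> opnorm (P 0) * B * H * \<tau> * exp (- \<gamma> * real k)"
      proof (rule mult_left_mono)
        show "exp (- r * real (Suc k) + - (\<alpha> * lam) * min k (l - k) + s * real k) \<le> exp (- \<gamma> * real k)"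
          using e1 e2 e3 by (subst exp_le_cancel_iff) (simp add: algebra_simps)
      qed (use P0 B pos \<tau> in auto)
      finally show ?thesis .
    qed
    have "opnorm (P T ** C p T - P 0 ** C p 0)
        \<le> (\<Sum>k<T. opnorm (P (Suc k)) * opnorm (A ((f ^^ k) x) - A ((f ^^ k) p)) * opnorm (C p k))"
    proof (rule opnorm_telescope)
      show "P k = P (Suc k) ** A ((f ^^ k) x)" if "k < T" for k
        unfolding P_def using that lT by (intro C_split_first) auto
    qed auto
    also have "\<dots> \<le> (\<Sum>k<T. opnorm (P 0) * B * H * \<tau> * exp (- \<gamma> * real k))"
      using term_le by (intro sum_mono) auto
    also have "\<dots> = (opnorm (P 0) * B * H * \<tau>) * (\<Sum>k<T. exp (- \<gamma> * real k))"
      by (simp add: sum_distrib_left)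
    also have "\<dots> \<le> (opnorm (P 0) * B * H * \<tau>) * S"
      unfolding S_def using sum_exp_le[OF \<gamma>] P0 B pos \<tau> by (intro mult_left_mono) auto
    also have "\<dots> = opnorm (P 0) * (B * H * S * \<tau>)"
      by (simp add: mult_ac)
    also have "\<dots> \<le> opnorm (P 0) * (1 / 2)"
      using \<tau> P0 by (intro mult_left_mono) auto
    finally have "opnorm (P T ** C p T - P 0) \<le> opnorm (P 0) / 2"
      by simp
    moreover have "opnorm (P 0) \<le> opnorm (P 0 - P T ** C p T) + opnorm (P T ** C p T)"
      using opnorm_add_le[of "P 0 - P T ** C p T" "P T ** C p T"] by simp
    moreover have "opnorm (P T ** C p T) \<le> (exp (- r * real T) * opnorm (P 0)) * opnorm (C p T)"
      using P[of T] lT by (intro opnorm_mult_le_mult) auto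
    ultimately have "opnorm (P 0) * 1 \<le> opnorm (P 0) * (2 * (exp (- r * real T) * opnorm (C p T)))"
      using opnorm_minus_commute[of "P 0"] by (simp add: mult_ac)
    then have "1 \<le> 2 * (exp (- r * real T) * opnorm (C p T))"
      using P0 by (simp only: mult_le_cancel_left_pos)
    then have "exp (r * real T) \<le> 2 * opnorm (C p T)"
      by (simp add: exp_minus field_simps)
    also have "\<dots> \<le> 2 * (exp (\<Lambda> * real d) * Q)"
    proof -
      have "C p T = Ci ((f ^^ T) p) d ** C p l"
        using C_eq_Ci_mult[of T l p] lT by simp
      then show ?thesis
        using opnorm_mult_le_mult[OF Ci_le periodic_le[OF lT(3) p]] by simp
    qed
    finally show ?thesis
      by (simp add: T_def mult_ac)
  qed
  with \<delta>(1) show ?thesis by (rule that)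
qed

lemma finite_net:
  assumes "\<delta> > 0"
  obtains Z where "finite Z" "\<And>x :: 'a. \<exists>z\<in>Z. dist z x < \<delta>"
proof -
  have cover: "(UNIV :: 'a set) \<subseteq> (\<Union>z\<in>UNIV. ball z \<delta>)"
    using assms by auto
  obtain Z where "finite Z" "(UNIV :: 'a set) \<subseteq> (\<Union>z\<in>Z. ball z \<delta>)"
    using compactE_image[OF compact _ cover] open_ball by metis
  with that show ?thesis by (auto simp: subset_iff)
qed

text \<open>The constants are chosen in the order: critical rate \<open>\<omega>\<close>; \<open>q\<close>, so large that growth at rate
  \<open>\<omega> / 2\<close> over \<open>q - 1\<close> blocks outweighs the trivial bound \<open>\<Lambda>\<close> on one block; rates \<open>r\<close> and \<open>s\<close> on
  the two sides of \<open>\<omega>\<close>; \<open>\<delta>\<close>; and last the number of record times needed to find two of them whose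
  points are \<open>\<delta>\<close>-close. That number does not enter the comparison with a periodic point, hence
  there is no circularity.\<close>

lemma subexponential_growth:
  assumes "\<epsilon> > 0"
  obtains B where "\<And>x n. opnorm (C x n) \<le> B * exp (\<epsilon> * real n)"
proof -
  define E where "E = {r. 0 \<le> r \<and> (\<exists>B. \<forall>x n. opnorm (C x n) \<le> B * exp (r * real n))}"
  define \<omega> where "\<omega> = Inf E"
  have "\<Lambda> \<in> E"
    using C_le pos unfolding E_def by (auto intro!: exI[of _ 1])
  then have ne: "E \<noteq> {}" by auto
  have bdd: "bdd_below E"
    by (auto simp: E_def bdd_below_def)
  show ?thesis
  proof (cases "\<exists>r\<in>E. r < \<epsilon>")
    case True
    then obtain r B where r: "r < \<epsilon>" and B: "\<And>x n. opnorm (C x n) \<le> B * exp (r * real n)"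
      by (auto simp: E_def)
    have "0 \<le> B"
      using B[of undefined 0] opnorm_nonneg[of "C undefined 0"] by simp
    have "opnorm (C x n) \<le> B * exp (\<epsilon> * real n)" for x n
    proof -
      have "r * real n \<le> \<epsilon> * real n"
        using r by (intro mult_right_mono) auto
      then have "B * exp (r * real n) \<le> B * exp (\<epsilon> * real n)"
        using \<open>0 \<le> B\<close> by (intro mult_left_mono) auto
      with B[of x n] show ?thesis by linarith
    qed
    then show ?thesis by (rule that)
  next
    case False
    then have "\<epsilon> \<le> \<omega>"
      unfolding \<omega>_def using ne by (intro cInf_greatest) force+
    then have \<omega>: "\<omega> > 0"
      using assms by simp
    define q where "q = nat \<lceil>2 * (\<Lambda> + 1) / \<omega>\<rceil> + 1"
    have q: "q > 0" "\<omega> / 2 * real (q - 1) \<ge> \<Lambda> + 1"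
    proof -
      have "2 * (\<Lambda> + 1) / \<omega> \<le> real (q - 1)"
        unfolding q_def using real_nat_ceiling_ge by simp
      then show "\<omega> / 2 * real (q - 1) \<ge> \<Lambda> + 1"
        using \<omega> by (simp add: field_simps)
    qed (simp add: q_def)
    define \<eta> where "\<eta> = min (\<alpha> * lam / (4 * real q)) (\<omega> / 2)"
    have \<eta>: "\<eta> > 0" "2 * \<eta> \<le> \<alpha> * lam / (2 * real q)" "\<eta> \<le> \<omega> / 2"
      using pos q \<omega> by (auto simp: \<eta>_def min_def field_simps)
    obtain s B where s: "s < \<omega> + \<eta>" and B: "\<And>x n. opnorm (C x n) \<le> B * exp (s * real n)"
      using cInf_lessD[OF ne, of "\<omega> + \<eta>"] \<eta>(1) by (auto simp: \<omega>_def E_def)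
    define r where "r = \<omega> - \<eta>"
    have r: "r \<ge> 0" "r \<ge> \<omega> / 2"
      using \<eta> \<omega> by (auto simp: r_def)
    have "r \<notin> E"
      using cInf_lower[OF _ bdd, of r] \<eta> by (auto simp: r_def \<omega>_def)
    then have unbounded: "\<exists>x n. B * exp (r * real n) < opnorm (C x n)" for B
      using r by (auto simp: E_def not_le)
    have gap: "s - r \<le> \<alpha> * lam / (2 * real q)"
      using s \<eta> by (simp add: r_def)
    obtain \<delta> where \<delta>: "\<delta> > 0" and bound:
      "\<And>x n d. d > 0 \<Longrightarrow> q * d \<le> n \<Longrightarrow> dist x ((f ^^ (q * d)) x) < \<delta> \<Longrightarrow>
        (\<And>j. j \<le> n \<Longrightarrow> opnorm (C ((f ^^ j) x) (n - j)) \<le> exp (- r * real j) * opnorm (C x n)) \<Longrightarrow>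
        exp (r * real ((q - 1) * d)) \<le> 2 * Q * exp (\<Lambda> * real d)"
      using record_time_closing_bound[OF r(1) B q(1) gap] by blast
    obtain Z where Z: "finite Z" "\<And>x :: 'a. \<exists>z\<in>Z. dist z x < \<delta> / 2"
      using finite_net[of "\<delta> / 2"] \<delta> by auto
    then obtain z where z: "\<And>x :: 'a. z x \<in> Z" "\<And>x. dist (z x) x < \<delta> / 2"
      by metis
    obtain l where l: "2 * Q < exp (real l)" "l > 0"
    proof -
      obtain l where "ln (2 * Q) < real l"
        using reals_Archimedean2 by blast
      then have "2 * Q < exp (real l)"
        using pos(7) by (metis exp_less_mono exp_ln mult_pos_pos zero_less_numeral)
      moreover have "exp (real l) \<le> exp (real (Suc l))"
        by simp
      ultimately show ?thesis
        by (intro that[of "Suc l"]) linarith+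
    qed
    obtain x n G where G: "G \<subseteq> {..n}" "card Z * (q * l) < card G"
      and good: "\<And>i j. i \<in> G \<Longrightarrow> i \<le> j \<Longrightarrow> j \<le> n \<Longrightarrow>
        opnorm (C ((f ^^ j) x) (n - j)) \<le> exp (- r * real (j - i)) * opnorm (C ((f ^^ i) x) (n - i))"
      using many_record_times[OF r(1) unbounded] by metis
    \<comment> \<open>The residue makes the distance of two times with equal value a positive multiple of \<open>q * l\<close>:
      the segment is long, and its length is divisible by \<open>q\<close>.\<close>
    define g where "g i = (z ((f ^^ i) x), i mod (q * l))" for i
    have "g ` G \<subseteq> Z \<times> {..<q * l}"
      using z(1) q l by (auto simp: g_def)
    then have "card (g ` G) \<le> card (Z \<times> {..<q * l})"
      using Z(1) by (intro card_mono) auto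
    then have "card (g ` G) < card G"
      using G(2) by (simp add: card_cartesian_product)
    then have "\<not> inj_on g G"
      by (rule pigeonhole)
    then obtain i j where ij: "i \<in> G" "j \<in> G" "i < j" "g i = g j"
      unfolding inj_on_def by (metis nat_neq_iff)
    then have "q * l dvd j - i"
      using mod_eq_dvd_iff_nat[of i j "q * l"] by (simp add: g_def)
    then obtain e where e: "j - i = q * (l * e)"
      by (metis dvdE mult.assoc)
    define d where "d = l * e"
    have "e > 0"
    proof (rule gr0I)
      assume "e = 0"
      with e have "j - i = 0" by (simp only: mult_0_right)
      with ij(3) show False by simp
    qed
    then have d: "d > 0" "l \<le> d"
      using l(2) by (simp_all add: d_def)
    have j: "(f ^^ (q * d)) ((f ^^ i) x) = (f ^^ j) x"
      using e ij funpow_add[of "q * d" i f] by (simp add: d_def flip: e)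
    have "exp (r * real ((q - 1) * d)) \<le> 2 * Q * exp (\<Lambda> * real d)"
    proof (rule bound[of d "n - i" "(f ^^ i) x"])
      show "d > 0" by fact
      show "q * d \<le> n - i"
        using e G(1) ij unfolding d_def by (metis atMost_iff diff_le_mono subsetD)
      have "z ((f ^^ i) x) = z ((f ^^ j) x)"
        using ij(4) by (simp add: g_def)
      then show "dist ((f ^^ i) x) ((f ^^ (q * d)) ((f ^^ i) x)) < \<delta>"
        unfolding j using z(2)[of "(f ^^ i) x"] z(2)[of "(f ^^ j) x"]
          dist_triangle3[of "(f ^^ i) x" "(f ^^ j) x" "z ((f ^^ i) x)"] by simp
      show "opnorm (C ((f ^^ k) ((f ^^ i) x)) (n - i - k)) \<le> exp (- r * real k) * opnorm (C ((f ^^ i) x) (n - i))"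
        if "k \<le> n - i" for k
        using good[OF ij(1), of "i + k"] that G(1) ij
        by (auto simp: funpow_add add.commute[of i] diff_diff_add)
    qed
    moreover have "exp (\<Lambda> * real d + real d) \<le> exp (r * real ((q - 1) * d))"
    proof -
      have "\<Lambda> + 1 \<le> r * real (q - 1)"
        using q(2) r(2) mult_right_mono[of "\<omega> / 2" r "real (q - 1)"] by linarith
      then have "(\<Lambda> + 1) * real d \<le> r * real (q - 1) * real d"
        by (rule mult_right_mono) simp
      then show ?thesis
        by (simp only: exp_le_cancel_iff of_nat_mult mult.assoc distrib_right mult_1_left)
    qed
    ultimately have "exp (\<Lambda> * real d + real d) \<le> 2 * Q * exp (\<Lambda> * real d)"
      by linarith
    then have "exp (\<Lambda> * real d) * exp (real d) \<le> exp (\<Lambda> * real d) * (2 * Q)"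
      by (simp only: exp_add mult.commute)
    then have "exp (real d) \<le> 2 * Q"
      by simp
    moreover have "exp (real l) \<le> exp (real d)"
      using d by simp
    ultimately show ?thesis using l by linarith
  qed
qed

lemma subexponential_growth_inv:
  assumes "\<epsilon> > 0"
  obtains B where "\<And>x n. opnorm (Ci x n) \<le> B * exp (\<epsilon> * real n)"
proof -
  interpret dual: bounded_periodic_cocycle f "\<lambda>x. transpose (matrix_inv (A x))" c lam \<delta>\<^sub>0 \<alpha> H \<Lambda> Q
    by (rule dual)
  show ?thesis
    using dual.subexponential_growth[OF assms] that
    by (auto simp: dual_cocycle_nat opnorm_transpose)
qed

section \<open>Orbit segments that nearly close\<close>

text \<open>Let \<open>p\<close> close the segment of \<open>x\<close> and split the segment in the middle, at \<open>u = f^m x\<close> and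
  \<open>v = f^m p\<close>. In the first half the orbits are exponentially close forwards, so \<open>A(p,m)^(-1) A(x,m)\<close> is
  near the identity; in the second half they are exponentially close backwards, so
  \<open>A(u,n-m) A(v,n-m)^(-1)\<close> is. Multiplying by these two matrices on either side turns \<open>A(p,n)\<close> into
  \<open>A(x,n)\<close>.\<close>

lemma closed_return_bound:
  obtains \<delta> where "\<delta> > 0"
    "\<And>x n. n > 0 \<Longrightarrow> dist x ((f ^^ n) x) < \<delta> \<Longrightarrow> opnorm (C x n) \<le> 4 * Q"
proof -
  define \<gamma> where "\<gamma> = \<alpha> * lam / 2"
  have \<gamma>: "\<gamma> > 0"
    using pos by (simp add: \<gamma>_def)
  obtain B1 where B1: "\<And>x n. opnorm (C x n) \<le> B1 * exp (\<gamma> / 2 * real n)"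
    using subexponential_growth[of "\<gamma> / 2"] \<gamma> by auto
  obtain B2 where B2: "\<And>x n. opnorm (Ci x n) \<le> B2 * exp (\<gamma> / 2 * real n)"
    using subexponential_growth_inv[of "\<gamma> / 2"] \<gamma> by auto
  have B: "0 \<le> B1" "0 \<le> B2"
    using B1[of undefined 0] B2[of undefined 0] 
      opnorm_nonneg[of "C undefined 0"] opnorm_nonneg[of "Ci undefined 0"] by auto
  define S where "S = 1 / (1 - exp (- \<gamma>))"
  have S: "S > 0"
    using \<gamma> by (simp add: S_def)
  define W where "W = B1 * B2 * exp \<gamma> * H * S"
  have "W \<ge> 0"
    using B S pos by (simp add: W_def)
  then obtain \<delta> where \<delta>: "\<delta> > 0" "\<delta> \<le> \<delta>\<^sub>0"
    and small: "\<And>t. 0 \<le> t \<Longrightarrow> t < \<delta> \<Longrightarrow> W * (c * t) powr \<alpha> \<le> 1 / 2"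
    using small_distances[of W c \<alpha> \<delta>\<^sub>0] pos by metis
  have "opnorm (C x n) \<le> 4 * Q" if n: "n > 0" and close: "dist x ((f ^^ n) x) < \<delta>" for x n
  proof -
    define \<tau> where "\<tau> = (c * dist x ((f ^^ n) x)) powr \<alpha>"
    have \<tau>: "0 \<le> \<tau>" "W * \<tau> \<le> 1 / 2"
      using small[of "dist x ((f ^^ n) x)"] close by (auto simp: \<tau>_def)
    have "dist x ((f ^^ n) x) < \<delta>\<^sub>0"
      using close \<delta>(2) by simp
    from closing_orbit[OF n this]
    obtain p where p: "(f ^^ n) p = p" and pA: "\<And>k. k \<le> n \<Longrightarrow>
        opnorm (A ((f ^^ k) x) - A ((f ^^ k) p)) \<le> H * \<tau> * exp (- (\<alpha> * lam) * min k (n - k))"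
      unfolding \<tau>_def by blast
    have sum_le: "(\<Sum>k<T. a k) \<le> 1 / 2"
      if "\<And>k. k < T \<Longrightarrow> a k \<le> B1 * B2 * H * \<tau> * exp \<gamma> * exp (- \<gamma> * real k)" for a T
    proof -
      have "(\<Sum>k<T. a k) \<le> (\<Sum>k<T. B1 * B2 * H * \<tau> * exp \<gamma> * exp (- \<gamma> * real k))"
        using that by (intro sum_mono) auto
      also have "\<dots> = B1 * B2 * H * \<tau> * exp \<gamma> * (\<Sum>k<T. exp (- \<gamma> * real k))"
        by (simp add: sum_distrib_left)
      also have "\<dots> \<le> B1 * B2 * H * \<tau> * exp \<gamma> * S"
        unfolding S_def using sum_exp_le[OF \<gamma>] B pos \<tau> by (intro mult_left_mono) auto
      also have "\<dots> = W * \<tau>"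
        by (simp add: W_def mult_ac)
      finally show ?thesis using \<tau> by simp
    qed
    have near_one: "opnorm M \<le> 2" if "opnorm (M - mat 1) \<le> 1 / 2" for M :: "real^'m^'m"
      using opnorm_add_le[of "M - mat 1" "mat 1"] that opnorm_mat1[where 'm='m] by simp
    \<comment> \<open>Rounding up: up to step \<open>m\<close> the nearer end is the first one, and from step \<open>m\<close> on the last one.\<close>
    define m where "m = n - n div 2"
    have m: "m \<le> n" "n - m \<le> m" "\<And>k. k < m \<Longrightarrow> k \<le> n - k"
      by (auto simp: m_def)
    have first: "opnorm (Ci p m ** C x m) \<le> 2"
    proof (rule near_one)
      have "opnorm (Ci p m ** C x m - Ci p 0 ** C x 0)
        \<le> (\<Sum>k<m. opnorm (Ci p (Suc k)) * opnorm (A ((f ^^ k) p) - A ((f ^^ k) x)) * opnorm (C x k))"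
      proof (rule opnorm_telescope)
        show "Ci p k = Ci p (Suc k) ** A ((f ^^ k) p)" for k
          using C_eq_Ci_mult[of 0 1 "(f ^^ k) p"]
          by (simp add: matrix_inv_mult invertible_A invertible_C matrix_mul_assoc[symmetric] matrix_inv_left)
      qed simp
      also have "\<dots> \<le> 1 / 2"
      proof (rule sum_le)
        fix k assume "k < m"
        with m have k: "k \<le> n" "min k (n - k) = k" by auto
        have "opnorm (Ci p (Suc k)) * opnorm (A ((f ^^ k) p) - A ((f ^^ k) x)) * opnorm (C x k)
          \<le> (B2 * exp (\<gamma> / 2 * real (Suc k))) * (H * \<tau> * exp (- (\<alpha> * lam) * k))
            * (B1 * exp (\<gamma> / 2 * real k))"
          using B1[of x k] B2[of p "Suc k"] pA[OF k(1)] B pos \<tau>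
          unfolding k opnorm_minus_commute[of "A ((f ^^ k) p)"]
          by (intro mult_mono mult_nonneg_nonneg opnorm_nonneg) auto
        also have "\<dots> = B1 * B2 * H * \<tau> * exp (\<gamma> / 2 * real (Suc k) + - (\<alpha> * lam) * k + \<gamma> / 2 * real k)"
          by (simp only: exp_add mult_ac)
        also have "\<dots> \<le> B1 * B2 * H * \<tau> * exp (\<gamma> + - \<gamma> * real k)"
          using B pos \<tau> \<gamma> by (intro mult_left_mono exp_le_cancel_iff[THEN iffD2])
            (auto simp: \<gamma>_def algebra_simps)
        also have "\<dots> = B1 * B2 * H * \<tau> * exp \<gamma> * exp (- \<gamma> * real k)"
          by (simp only: exp_add mult_ac)
        finally show "opnorm (Ci p (Suc k)) * opnorm (A ((f ^^ k) p) - A ((f ^^ k) x)) * opnorm (C x k)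
          \<le> B1 * B2 * H * \<tau> * exp \<gamma> * exp (- \<gamma> * real k)" .
      qed
      finally show "opnorm (Ci p m ** C x m - mat 1) \<le> 1 / 2"
        by (simp add: matrix_inv_mat1)
    qed
    define u v where "u = (f ^^ m) x" and "v = (f ^^ m) p"
    define N where "N = n - m"
    have second: "opnorm (C u N ** Ci v N) \<le> 2"
    proof (rule near_one)
      define P where "P k = C ((f ^^ k) u) (N - k)" for k
      define R where "R k = Ci ((f ^^ k) v) (N - k)" for k
      have "opnorm (P N ** R N - P 0 ** R 0)
        \<le> (\<Sum>k<N. opnorm (P (Suc k)) * opnorm (A ((f ^^ k) u) - A ((f ^^ k) v)) * opnorm (R k))"
      proof (rule opnorm_telescope)
        show "P k = P (Suc k) ** A ((f ^^ k) u)" if "k < N" for k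
          unfolding P_def using that by (rule C_split_first)
        show "R (Suc k) = A ((f ^^ k) v) ** R k" if "k < N" for k
          unfolding R_def C_split_first[OF that]
          by (simp add: matrix_inv_mult invertible_A invertible_C matrix_mul_assoc matrix_inv_right)
      qed
      \<comment> \<open>Counted from the end of the segment, the closeness decays in the summation index.\<close>
      also have "\<dots> = (\<Sum>k<N. opnorm (P (N - k)) * opnorm (A ((f ^^ (N - Suc k)) u) - A ((f ^^ (N - Suc k)) v))
          * opnorm (R (N - Suc k)))"
        by (subst sum.nat_diff_reindex[symmetric]) (auto intro!: sum.cong simp: Suc_diff_Suc)
      also have "\<dots> \<le> 1 / 2"
      proof (rule sum_le)
        fix k assume k: "k < N"
        define i where "i = m + (N - Suc k)"
        have i: "i \<le> n" "min i (n - i) \<ge> k"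
          using k m by (auto simp: N_def i_def)
        have fu: "(f ^^ (N - Suc k)) u = (f ^^ i) x" "(f ^^ (N - Suc k)) v = (f ^^ i) p"
          by (simp_all add: u_def v_def i_def funpow_add add.commute[of m])
        have P: "opnorm (P (N - k)) \<le> B1 * exp (\<gamma> / 2 * real k)"
          using B1[of _ k] k by (simp add: P_def)
        have R: "opnorm (R (N - Suc k)) \<le> B2 * exp (\<gamma> / 2 * real (Suc k))"
          using B2[of _ "Suc k"] k by (simp add: R_def)
        have "exp (- (\<alpha> * lam) * min i (n - i)) \<le> exp (- (\<alpha> * lam) * k)"
          using i(2) pos by (simp add: mult_left_mono del: min.bounded_iff)
        then have "H * \<tau> * exp (- (\<alpha> * lam) * min i (n - i)) \<le> H * \<tau> * exp (- (\<alpha> * lam) * k)"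
          using pos \<tau> by (intro mult_left_mono) auto
        then have A: "opnorm (A ((f ^^ i) x) - A ((f ^^ i) p)) \<le> H * \<tau> * exp (- (\<alpha> * lam) * k)"
          using pA[OF i(1)] by linarith
        have "opnorm (P (N - k)) * opnorm (A ((f ^^ i) x) - A ((f ^^ i) p)) * opnorm (R (N - Suc k))
          \<le> (B1 * exp (\<gamma> / 2 * real k)) * (H * \<tau> * exp (- (\<alpha> * lam) * k))
            * (B2 * exp (\<gamma> / 2 * real (Suc k)))"
          using P A R B pos \<tau>
          by (intro mult_mono mult_nonneg_nonneg opnorm_nonneg) auto
        also have "\<dots> = B1 * B2 * H * \<tau> * exp (\<gamma> / 2 * real k + - (\<alpha> * lam) * k + \<gamma> / 2 * real (Suc k))"
          by (simp only: exp_add mult_ac)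
        also have "\<dots> \<le> B1 * B2 * H * \<tau> * exp (\<gamma> + - \<gamma> * real k)"
          using B pos \<tau> \<gamma> by (intro mult_left_mono exp_le_cancel_iff[THEN iffD2])
            (auto simp: \<gamma>_def algebra_simps)
        also have "\<dots> = B1 * B2 * H * \<tau> * exp \<gamma> * exp (- \<gamma> * real k)"
          by (simp only: exp_add mult_ac)
        finally show "opnorm (P (N - k)) * opnorm (A ((f ^^ (N - Suc k)) u) - A ((f ^^ (N - Suc k)) v))
            * opnorm (R (N - Suc k)) \<le> B1 * B2 * H * \<tau> * exp \<gamma> * exp (- \<gamma> * real k)"
          unfolding fu .
      qed
      finally have "opnorm (mat 1 - C u N ** Ci v N) \<le> 1 / 2"
        by (simp add: P_def R_def matrix_inv_mat1)
      then show "opnorm (C u N ** Ci v N - mat 1) \<le> 1 / 2"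
        by (simp only: opnorm_minus_commute)
    qed
    have "C x n = C u N ** C x m" "C p n = C v N ** C p m"
      using C_split[OF m(1)] by (simp_all add: u_def v_def N_def)
    then have "C u N ** Ci v N ** C p n ** (Ci p m ** C x m) = C u N ** (Ci v N ** C v N) ** (C p m ** Ci p m) ** C x m"
      by (simp only: matrix_mul_assoc)
    also have "\<dots> = C x n"
      using \<open>C x n = _\<close> by (simp add: matrix_inv_left matrix_inv_right invertible_C)
    finally have "opnorm (C x n) \<le> 2 * Q * 2"
      using first second periodic_le[OF n p] opnorm_mult_le_mult by metis
    then show ?thesis by simp
  qed
  with \<delta>(1) show ?thesis by (rule that)
qed

text \<open>The summand \<open>1\<close> is for \<open>n = 0\<close>, when the product is the identity.\<close>

lemma return_bound:
  obtains \<delta> where "\<delta> > 0"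
    "\<And>x n. dist x ((f ^^ n) x) < \<delta> \<Longrightarrow>
      opnorm (C x n) \<le> 4 * Q + 1 \<and> opnorm (Ci x n) \<le> 4 * Q + 1"
proof -
  interpret dual: bounded_periodic_cocycle f "\<lambda>x. transpose (matrix_inv (A x))" c lam \<delta>\<^sub>0 \<alpha> H \<Lambda> Q
    by (rule dual)
  obtain \<delta>1 where \<delta>1: "\<delta>1 > 0"
    "\<And>x n. n > 0 \<Longrightarrow> dist x ((f ^^ n) x) < \<delta>1 \<Longrightarrow> opnorm (C x n) \<le> 4 * Q"
    using closed_return_bound by blast
  obtain \<delta>2 where \<delta>2: "\<delta>2 > 0"
    "\<And>x n. n > 0 \<Longrightarrow> dist x ((f ^^ n) x) < \<delta>2 \<Longrightarrow> opnorm (Ci x n) \<le> 4 * Q"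
    using dual.closed_return_bound unfolding dual_cocycle_nat opnorm_transpose by blast
  show ?thesis
  proof (rule that[of "min \<delta>1 \<delta>2"])
    show "min \<delta>1 \<delta>2 > 0"
      using \<delta>1 \<delta>2 by simp
    show "opnorm (C x n) \<le> 4 * Q + 1 \<and> opnorm (Ci x n) \<le> 4 * Q + 1"
      if "dist x ((f ^^ n) x) < min \<delta>1 \<delta>2" for x n
      using \<delta>1(2)[of n x] \<delta>2(2)[of n x] that pos opnorm_mat1[where 'm='m]
      by (cases "n = 0") (auto simp: matrix_inv_mat1)
  qed
qed

section \<open>From the dense orbit to the whole space\<close>

definition transition :: "'a \<Rightarrow> nat \<Rightarrow> nat \<Rightarrow> real^'m^'m" where
  "transition x i j = C x j ** Ci x i"

lemma transition_trans: "transition x j k ** transition x i j = transition x i k"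
proof -
  have "transition x j k ** transition x i j = C x k ** (Ci x j ** C x j) ** Ci x i"
    by (simp add: transition_def matrix_mul_assoc)
  then show ?thesis
    by (simp add: transition_def matrix_inv_left invertible_C)
qed

lemma transition_forward: "i \<le> j \<Longrightarrow> transition x i j = C ((f ^^ i) x) (j - i)"
  unfolding transition_def C_split[of i j x]
  by (simp add: matrix_inv_right invertible_C flip: matrix_mul_assoc)

lemma transition_backward: "i \<le> j \<Longrightarrow> transition x j i = Ci ((f ^^ i) x) (j - i)"
  unfolding transition_def C_split[of i j x]
  by (simp add: matrix_inv_mult matrix_inv_right invertible_C matrix_mul_assoc)

lemma opnorm_transition_le:
  assumes "j \<le> i + N" "i \<le> j + N"
  shows "opnorm (transition x i j) \<le> exp (\<Lambda> * real N)"
proof -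
  have mono: "exp (\<Lambda> * real k) \<le> exp (\<Lambda> * real N)" if "k \<le> N" for k
    using that pos by simp
  show ?thesis
  proof (cases "i \<le> j")
    case True
    then show ?thesis
      using order_trans[OF C_le mono, of "j - i" "(f ^^ i) x"] assms by (simp add: transition_forward)
  next
    case False
    then show ?thesis
      using order_trans[OF Ci_le mono, of "i - j" "(f ^^ j) x"] assms by (simp add: transition_backward)
  qed
qed

text \<open>The points \<open>f^k z\<close> with \<open>|k| \<le> N\<close> form a \<open>\<delta>\<close>-net. To go from time \<open>k\<close> to time \<open>k + n\<close>, jump to a
  time \<open>k'\<close> of the net whose point is close to that of \<open>k\<close>, move inside the net to a time \<open>l'\<close> whose
  point is close to that of \<open>k + n\<close>, and jump there. A jump between close points of one orbit is a
  nearly closed segment, traversed forwards or backwards.\<close>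

lemma bounded_along_dense_orbit:
  assumes "bij f" and dense: "closure (range (\<lambda>k::int. iterate f k z)) = UNIV"
  obtains R where "\<And>k n. opnorm (C (iterate f k z) n) \<le> R"
proof -
  obtain \<delta> where \<delta>: "\<delta> > 0" and ret: "\<And>x n. dist x ((f ^^ n) x) < \<delta> \<Longrightarrow>
      opnorm (C x n) \<le> 4 * Q + 1 \<and> opnorm (Ci x n) \<le> 4 * Q + 1"
    using return_bound by blast
  let ?z = "\<lambda>k. iterate f k z"
  obtain N :: int where N: "N \<ge> 0" "\<And>x. \<exists>k. \<bar>k\<bar> \<le> N \<and> dist (?z k) x < \<delta>"
  proof -
    have "\<exists>k. dist (?z k) x < \<delta>" for x
      using dense \<delta> closure_approachable[of x "range ?z"] by auto
    then have cover: "(UNIV :: 'a set) \<subseteq> (\<Union>k\<in>UNIV. ball (?z k) \<delta>)"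
      by auto
    obtain I where I: "finite I" "(UNIV :: 'a set) \<subseteq> (\<Union>k\<in>I. ball (?z k) \<delta>)"
      using compactE_image[OF compact _ cover] open_ball by metis
    have "\<exists>k. \<bar>k\<bar> \<le> (\<Sum>k\<in>I. \<bar>k\<bar>) \<and> dist (?z k) x < \<delta>" for x
    proof -
      obtain k where "k \<in> I" "dist (?z k) x < \<delta>"
        using I(2) by (auto simp: subset_iff)
      moreover have "\<bar>k\<bar> \<le> (\<Sum>k\<in>I. \<bar>k\<bar>)"
        using I(1) \<open>k \<in> I\<close> by (intro member_le_sum) auto
      ultimately show ?thesis by blast
    qed
    then show ?thesis
      by (intro that[of "\<Sum>k\<in>I. \<bar>k\<bar>"]) auto
  qed
  define R where "R = (4 * Q + 1) * exp (\<Lambda> * real (nat (2 * N))) * (4 * Q + 1)"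
  have "opnorm (C (?z k) n) \<le> R" for k n
  proof -
    obtain k' where k': "\<bar>k'\<bar> \<le> N" "dist (?z k') (?z k) < \<delta>"
      using N(2) by blast
    obtain l' where l': "\<bar>l'\<bar> \<le> N" "dist (?z l') (?z (k + n)) < \<delta>"
      using N(2) by blast
    \<comment> \<open>A starting time before all times involved, so that they are natural numbers counted from it.\<close>
    define b where "b = min k (- N)"
    define w where "w = ?z b"
    have w: "(f ^^ nat (a - b)) w = ?z a" if "b \<le> a" for a
      using iterate_add_nat[OF assms(1), of "nat (a - b)" b z] that by (simp add: w_def)
    have near: "opnorm (transition w (nat (a - b)) (nat (a' - b))) \<le> 4 * Q + 1"
      if "b \<le> a" "b \<le> a'" "dist (?z a) (?z a') < \<delta>" for a a'
    proof -
      have *: "(f ^^ (nat (a' - b) - nat (a - b))) (?z a) = ?z a'" if "b \<le> a" "a \<le> a'" for a a'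
        using iterate_add_nat[OF assms(1), of "nat (a' - b) - nat (a - b)" a z] that by simp
      show ?thesis
      proof (cases "a \<le> a'")
        case True
        then show ?thesis
          using that ret[of "?z a" "nat (a' - b) - nat (a - b)"] w[of a]
          by (simp add: transition_forward *)
      next
        case False
        then show ?thesis
          using that ret[of "?z a'" "nat (a - b) - nat (a' - b)"] w[of a']
          by (simp add: transition_backward * dist_commute)
      qed
    qed
    let ?i = "\<lambda>a. nat (a - b)"
    have le: "b \<le> k" "b \<le> k'" "b \<le> l'" "b \<le> k + n"
      using k' l' by (auto simp: b_def)
    have "?i (k + n) - ?i k = n"
      using le by arith
    then have "C (?z k) n = transition w (?i k) (?i (k + n))"
      using transition_forward[of "?i k" "?i (k + n)" w] le w[of k] by simp
    also have "\<dots> = transition w (?i l') (?i (k + n)) ** transition w (?i k') (?i l')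
        ** transition w (?i k) (?i k')"
      by (simp add: transition_trans)
    also have "opnorm \<dots> \<le> R"
      unfolding R_def
    proof (intro opnorm_mult_le_mult near le)
      show "opnorm (transition w (?i k') (?i l')) \<le> exp (\<Lambda> * real (nat (2 * N)))"
        using k' l' le by (intro opnorm_transition_le) linarith+
    qed (use k' l' in \<open>auto simp: dist_commute\<close>)
    finally show ?thesis .
  qed
  then show ?thesis by (rule that)
qed

lemma cocycle_nat_bounded:
  assumes "bij f" "continuous_on UNIV f"
    and dense: "closure (range (\<lambda>k::int. iterate f k z)) = UNIV"
  obtains R where "\<And>x n. opnorm (C x n) \<le> R"
proof -
  obtain R where R: "\<And>k n. opnorm (C (iterate f k z) n) \<le> R"
    using bounded_along_dense_orbit[OF assms(1) dense] by blast
  have "continuous_on UNIV A"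
    unfolding continuous_on_def
  proof
    fix x :: 'a
    have "((\<lambda>y. (real CARD('m))\<^sup>2 * (H * dist y x powr \<alpha>)) \<longlongrightarrow> (real CARD('m))\<^sup>2 * (H * 0)) (at x)"
      using pos(4)
      by (intro tendsto_intros tendsto_zero_powrI[where b=\<alpha>] tendsto_const)
         (auto intro!: tendsto_eq_intros)
    then have lim: "((\<lambda>y. (real CARD('m))\<^sup>2 * (H * dist y x powr \<alpha>)) \<longlongrightarrow> 0) (at x)"
      by simp
    have "norm (A y - A x) \<le> (real CARD('m))\<^sup>2 * (H * dist y x powr \<alpha>)" for y
      using norm_le_opnorm[of "A y - A x"] A_holder[of y x]
      by (meson mult_left_mono order_trans zero_le_power2)
    then have "((\<lambda>y. A y - A x) \<longlongrightarrow> 0) (at x)"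
      by (intro Lim_null_comparison[OF _ lim] always_eventually allI)
    then show "(A \<longlongrightarrow> A x) (at x)"
      by (rule LIM_zero_cancel)
  qed
  have "opnorm (C x n) \<le> R" for x n
  proof -
    have "x \<in> closure (range (\<lambda>k::int. iterate f k z))"
      using dense by simp
    then obtain y where y: "\<And>i. y i \<in> range (\<lambda>k::int. iterate f k z)" "y \<longlonglongrightarrow> x"
      by (auto simp: closure_sequential)
    have "(\<lambda>i. C (y i) n) \<longlonglongrightarrow> C x n"
      using continuous_on_tendsto_compose[OF continuous_cocycle_nat[OF assms(2) \<open>continuous_on UNIV A\<close>] y(2)]
      by simp
    moreover have "opnorm (C (y i) n) \<le> R" for i
      using y(1)[of i] R by auto
    ultimately show ?thesis
      by (rule opnorm_le_limit)
  qed
  then show ?thesis by (rule that)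
qed

lemma cocycle_nat_inv_bounded:
  assumes "bij f" "continuous_on UNIV f"
    and "closure (range (\<lambda>k::int. iterate f k z)) = UNIV"
  obtains R where "\<And>x n. opnorm (Ci x n) \<le> R"
proof -
  interpret dual: bounded_periodic_cocycle f "\<lambda>x. transpose (matrix_inv (A x))" c lam \<delta>\<^sub>0 \<alpha> H \<Lambda> Q
    by (rule dual)
  show ?thesis
    using dual.cocycle_nat_bounded[OF assms] that unfolding dual_cocycle_nat opnorm_transpose by blast
qed

end

theorem theorem1p2:
  fixes f :: "'a::metric_space \<Rightarrow> 'a"
    and A :: "'a \<Rightarrow> real^'m^'m"
    and \<alpha> :: real
    and K :: "(real^'m^'m) set"
  assumes "compact (UNIV :: 'a set)"
    and "homeomorphism UNIV UNIV f (inv f)"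
    and "topologically_transitive f"
    and "closing_property f"
    and "\<alpha> > 0"
    and "holder_GL \<alpha> A"
    and "compactin GL_topology K"
    and "\<And>p n. n > 0 \<Longrightarrow> (f ^^ n) p = p \<Longrightarrow> cocycle f A p (int n) \<in> K"
  shows "\<exists>K'. compactin GL_topology K' \<and> (\<forall>x k. cocycle f A x k \<in> K')"
proof -
  obtain Q where Q: "Q > 0" "\<And>M. M \<in> K \<Longrightarrow> opnorm M \<le> Q \<and> opnorm (matrix_inv M) \<le> Q"
    using compactin_GL_bounded[OF assms(7)] by blast
  obtain H \<Lambda> where H: "H \<ge> 0" "\<Lambda> > 0"
    "\<And>x y. GL_dist (A x) (A y) \<le> H * dist x y powr \<alpha>"
    "\<And>x. opnorm (A x) \<le> exp \<Lambda>" "\<And>x. opnorm (matrix_inv (A x)) \<le> exp \<Lambda>"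
    using holder_GL_bounded[OF assms(1,5,6)] by blast
  obtain c lam \<delta>\<^sub>0 where c: "c > 0" "lam > 0" "\<delta>\<^sub>0 > 0" and closing:
    "\<And>x n. n > 0 \<Longrightarrow> dist x ((f ^^ n) x) < \<delta>\<^sub>0 \<Longrightarrow>
      \<exists>p. (f ^^ n) p = p \<and> exponentially_close f lam (c * dist x ((f ^^ n) x)) n x p"
    using assms(4) unfolding closing_property_def Let_def by metis
  interpret bounded_periodic_cocycle f A c lam \<delta>\<^sub>0 \<alpha> H \<Lambda> Q
  proof
    show "invertible (A x)" for x
      using assms(6) by (auto simp: holder_GL_def GL_def)
    show "opnorm (A x - A y) \<le> H * dist x y powr \<alpha>"
      "opnorm (matrix_inv (A x) - matrix_inv (A y)) \<le> H * dist x y powr \<alpha>" for x y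
      using H(3)[of x y] opnorm_nonneg[of "A x - A y"]
        opnorm_nonneg[of "matrix_inv (A x) - matrix_inv (A y)"] by (auto simp: GL_dist_def)
    show "opnorm (cocycle_nat f A p n) \<le> Q" "opnorm (matrix_inv (cocycle_nat f A p n)) \<le> Q"
      if "n > 0" "(f ^^ n) p = p" for p n
      using Q(2)[OF assms(8)[OF that]] by (simp_all add: cocycle_def)
  qed (use assms c H Q closing in auto)
  have f: "bij f" "continuous_on UNIV f"
    using assms(2) by (auto simp: homeomorphism_def intro: bij_betw_byWitness[of _ "inv f"])
  obtain z where z: "closure (range (\<lambda>k::int. iterate f k z)) = UNIV"
    using assms(3) by (auto simp: topologically_transitive_def)
  obtain R1 R2 where R: "\<And>x n. opnorm (C x n) \<le> R1" "\<And>x n. opnorm (Ci x n) \<le> R2"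
    using cocycle_nat_bounded[OF f z] cocycle_nat_inv_bounded[OF f z] by metis
  define R where "R = max R1 R2"
  have R: "opnorm (C x n) \<le> R" "opnorm (Ci x n) \<le> R" for x n
    using R[of x n] by (auto simp: R_def)
  let ?K' = "{M :: real^'m^'m. M \<in> GL \<and> opnorm M \<le> R \<and> opnorm (matrix_inv M) \<le> R}"
  have "cocycle f A x k \<in> ?K'" for x k
    by (simp add: cocycle_def GL_def R invertible_C invertible_matrix_inv matrix_inv_inv)
  with compactin_GL_opnorm_ball show ?thesis
    by blast
qed

end
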